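(* Let $d\ge 2$, $N\ge 1$, and consider the control system $$\begin{cases}\dot x_i = K_i(x_i-x_{N+1})+F_i(x), & 1\le i\le N,\\ \dot x_{N+1}=F_{N+1}(x)+\zeta,\\ x(0)=x_{\mathfrak{in}},\end{cases}$$ for $x=(x_1,\dots,x_{N+1})$ with values in $\Delta_{N+1}^{\complement}$, where $K_1,\dots,K_N,F_1,\dots,F_{N+1}$ satisfy the structural assumptions listed in the context. Let $T_{\mathfrak f}>0$, $x_{\mathfrak{in}},x_{\mathfrak f}\in\Delta_{N+1}^{\complement}$, and $\varepsilon>0$. Let $\mathfrak c=(\mathfrak c_1,\dots,\mathfrak c_N)\in C^0([0,T_{\mathfrak f}];\Delta_N^{\complement})$ be a curve with $$(\mathfrak c(0),x_{\mathfrak{in},N+1})=x_{\mathfrak{in}},\qquad (\mathfrak c(T_{\mathfrak f}),x_{\mathfrak f,N+1})=x_{\mathfrak f}.$$ Then there is a control $\zeta\in C^\infty_c((0,T_{\mathfrak f});\mathbb R^d)$ such that the solution $x$ of the system (exists on $[0,T_{\mathfrak f}]$ and) satisfies $$\sup_{t\in[0,T_{\mathfrak f}]}\sum_{i=1}^N|\mathfrak c_i(t)-x_i(t)|+|x_{N+1}(T_{\mathfrak f})-x_{\mathfrak f,N+1}|<\varepsilon.$$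
   Context: Notation: $\mathcal M=\mathbb R^d$ and, for $n\ge1$, $\Delta_n=\{x\in\mathcal M^n : \exists\, i\ne j,\ x_i=x_j\}$, $\Delta_n^{\complement}=\mathcal M^n\setminus\Delta_n$. $|\cdot|$ is the Euclidean norm; $x_{\mathfrak{in},i}$ and $x_{\mathfrak f,i}$ denote the $i$-th components in $\mathcal M$ of $x_{\mathfrak{in}}$ and $x_{\mathfrak f}$. Structural assumptions: $F_1,\dots,F_{N+1}\colon\Delta_{N+1}^{\complement}\to\mathbb R^d$ and $K_1,\dots,K_N\colon\mathcal M\setminus\{0\}\to\mathbb R^d$ are continuous. For $1\le i\le N$, $$F_i(x_1,\dots,x_{N+1})=\widetilde F_i(x_1,\dots,x_N)+\widehat F_i(x_1,\dots,x_{N+1}),\qquad K_i(z)=f_i(|z|)\frac{A_iz}{|z|^{p_i}},$$ where $\widetilde F_i$ is locally Lipschitz on $\Delta_N^{\complement}$, $\widehat F_i$ is locally Lipschitz on $\mathcal M^{N+1}$, $A_i$ is an invertible real $d\times d$ matrix, $f_i\colon[0,\infty)\to\mathbb R$ is bounded and Lipschitz with $f_i(0)\ne0$, and $p_i>1$. Moreover $F_{N+1}$ is locally Lipschitz on $\Delta_{N+1}^{\complement}$. *)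

theory Defs
  imports "HOL-Analysis.Analysis"
begin

text \<open>
  The finite type \<open>'n\<close> indexes the \<open>N \<ge> 1\<close> driven particles. The \<open>N + 1\<close> particles are indexed by
  \<open>'n option\<close>: \<open>Some i\<close> is the \<open>i\<close>-th driven particle and \<open>None\<close> is the last, controlled one.
\<close>

definition diagonals :: "('a ^ 'n) set" where
  "diagonals = {x. \<exists>i j. i \<noteq> j \<and> x $ i = x $ j}"

definition init_part :: "'a ^ ('n::finite option) \<Rightarrow> 'a ^ 'n" where
  "init_part x = (\<chi> i. x $ Some i)"

definition append_last :: "'a ^ 'n \<Rightarrow> 'a \<Rightarrow> 'a ^ ('n::finite option)" where
  "append_last y z = (\<chi> k. case k of None \<Rightarrow> z | Some i \<Rightarrow> y $ i)"

text \<open>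
  The library's \<open>local_lipschitz\<close> is about time-dependent maps; here the time argument is a dummy.
\<close>
definition locally_lipschitz_on :: "'a::metric_space set \<Rightarrow> ('a \<Rightarrow> 'b::metric_space) \<Rightarrow> bool" where
  "locally_lipschitz_on S f \<longleftrightarrow> local_lipschitz (UNIV :: real set) S (\<lambda>_. f)"

text \<open>
  Elements of \<open>C\<^sub>c\<^sup>\<infinity>((a,b))\<close> are represented by their extension by zero to the whole real line.
\<close>
definition Cc_infinity :: "real \<Rightarrow> real \<Rightarrow> (real \<Rightarrow> 'a::real_normed_vector) set" where
  "Cc_infinity a b = {g.
     (\<forall>k. ((\<lambda>h t. vector_derivative h (at t)) ^^ k) g differentiable_on UNIV) \<and>
     compact (closure {t. g t \<noteq> 0}) \<and> closure {t. g t \<noteq> 0} \<subseteq> {a<..<b}}"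

text \<open>
  At the endpoints of \<open>[0,T]\<close> the derivatives are one-sided.
\<close>
definition solves_system ::
  "('n::finite \<Rightarrow> real ^ 'd \<Rightarrow> real ^ 'd) \<Rightarrow>
   ('n option \<Rightarrow> (real ^ 'd) ^ ('n option) \<Rightarrow> real ^ 'd) \<Rightarrow>
   (real \<Rightarrow> real ^ 'd) \<Rightarrow> real \<Rightarrow> (real ^ 'd) ^ ('n option) \<Rightarrow>
   (real \<Rightarrow> (real ^ 'd) ^ ('n option)) \<Rightarrow> bool" where
  "solves_system K F \<zeta> T x_in x \<longleftrightarrow>
     x 0 = x_in \<and>
     (\<forall>t\<in>{0..T}.
        x t \<notin> diagonals \<and>
        (\<forall>i. ((\<lambda>s. x s $ Some i) has_vector_derivative
               K i (x t $ Some i - x t $ None) + F (Some i) (x t)) (at t within {0..T})) \<and>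
        ((\<lambda>s. x s $ None) has_vector_derivative
               F None (x t) + \<zeta> t) (at t within {0..T}))"

end

theory Submission
  imports Defs
begin

text \<open>
  Call the first \<open>N\<close> particles the driven ones and the last one the controlled one. The additive
  control acts on the velocity of the controlled particle, so the position of that particle is
  itself practically the control: a continuous path \<open>z\<close> of it is produced by the (merely formal)
  control \<open>z' - F\<^bsub>N+1\<^esub>\<close>. The proof has two halves.

  The geometric half finds a continuous path of the controlled particle under which the driven
  particles follow \<open>c\<close>. Because \<open>p\<^sub>i > 1\<close> and \<open>f\<^sub>i(0) \<noteq> 0\<close>, the force \<open>K\<^sub>i(w)\<close> is unbounded at \<open>w = 0\<close>,
  and it takes every sufficiently large value at an offset \<open>w\<close> as small as desired
  (\<open>large_velocities_attained\<close>). Keeping the controlled particle at a constant small offset \<open>w\<close>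
  from particle \<open>i\<close> for a short time \<open>d\<close> therefore displaces particle \<open>i\<close> by about \<open>d K\<^sub>i(w)\<close>, a
  vector of our choice, provided that it is not too short. All other forces, including those on
  particle \<open>i\<close> itself, stay bounded independently of \<open>w\<close> (\<open>close_interaction_bounds\<close>; this is
  where the splitting of \<open>F\<^sub>i\<close> matters, as \<open>F_hat\<close> has no singularity when the controlled particle
  comes close), so everything else moves by \<open>O(d)\<close> only. A displacement
  that is too short never has to be made: the goal is a position near \<open>c\<^sub>i\<close>, and one can always
  pick such a position at distance at least \<open>\<eta>\<close> from the current one. Treating the particles in
  turn and repeating this at a high frequency keeps all of them within a few \<open>\<eta>\<close> of \<open>c\<close>.
  The controlled particle has to be relocated between two pushes, and at the end to its final
  position.
  In dimension at least two the complement of the driven particles is path connected, and a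
  compact path in it can be run through so quickly that the forces, however large, have no time to act
  (\<open>relocate_controlled_particle\<close>). The outcome is \<open>shadow_curve\<close>.

  The analytic half makes the control smooth. In integrated form the control enters the equation as
  an additive forcing \<open>\<integral>\<^sub>0\<^sup>t \<zeta>\<close>, and the solution depends continuously, in the uniform norm, on this
  primitive alone. So it suffices that every continuous function vanishing at \<open>0\<close> is a uniform
  limit of primitives of test functions (\<open>approximate_by_integral_of_test_function\<close>), and the
  required control is obtained from the path without ever differentiating it
  (\<open>smooth_control_near\<close>).
\<close>

section \<open>Ordinary differential equations with a rough additive forcing\<close>

lemma integral_weighted_exp:
  fixes L a t m :: real
  assumes "L > 0" "a \<le> t"
  shows "((\<lambda>s. m * exp (2 * L * (s - a))) has_integral m * (exp (2 * L * (t - a)) - 1) / (2 * L)) {a..t}"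
proof -
  have "((\<lambda>s. m * exp (2 * L * (s - a))) has_integral
      m * exp (2 * L * (t - a)) / (2 * L) - m * exp (2 * L * (a - a)) / (2 * L)) {a..t}"
    using assms
    by (intro fundamental_theorem_of_calculus)
       (auto intro!: derivative_eq_intros simp: has_real_derivative_iff_has_vector_derivative[symmetric])
  then show ?thesis by (simp add: algebra_simps diff_divide_distrib)
qed

text \<open>
  Let \<open>m\<close> be the maximum of \<open>u\<close> weighted by \<open>exp (- 2 L (t - a))\<close>. With the weight \<open>2 L\<close> instead
  of \<open>L\<close> the integral term contributes at most half of \<open>m\<close>, hence \<open>m \<le> 2 \<delta>\<close>. The constants are not
  the optimal ones.
\<close>
lemma gronwall:
  fixes u :: "real \<Rightarrow> real"
  assumes cont: "continuous_on {a..b} u" and L: "L > 0" and \<delta>: "\<delta> \<ge> 0"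
    and ineq: "\<And>t. t \<in> {a..b} \<Longrightarrow> u t \<le> \<delta> + L * integral {a..t} u"
    and t: "t \<in> {a..b}"
  shows "u t \<le> 2 * \<delta> * exp (2 * L * (t - a))"
proof -
  define g where "g s = u s * exp (- (2 * L * (s - a)))" for s
  have "continuous_on {a..b} g"
    unfolding g_def by (intro continuous_intros cont)
  then obtain t0 where t0: "t0 \<in> {a..b}" and max: "\<And>s. s \<in> {a..b} \<Longrightarrow> g s \<le> g t0"
    using continuous_attains_sup[of "{a..b}" g] t by fastforce
  define m where "m = g t0"
  define e where "e = exp (2 * L * (t0 - a))"
  have e1: "e \<ge> 1" using L t0 by (simp add: e_def)
  have u_le: "u s \<le> m * exp (2 * L * (s - a))" if "s \<in> {a..b}" for s
  proof -
    have "u s = g s * exp (2 * L * (s - a))" by (simp add: g_def exp_minus)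
    also have "\<dots> \<le> m * exp (2 * L * (s - a))"
      using max[OF that] by (intro mult_right_mono) (auto simp: m_def)
    finally show ?thesis .
  qed
  have u_t0: "u t0 = m * e"
    by (simp add: m_def g_def e_def exp_minus)
  have "integral {a..t0} u \<le> integral {a..t0} (\<lambda>s. m * exp (2 * L * (s - a)))"
    using t0 u_le
    by (intro integral_le integrable_continuous_real continuous_on_subset[OF cont] continuous_intros) auto
  also have "\<dots> = m * (e - 1) / (2 * L)"
    unfolding e_def by (rule integral_unique[OF integral_weighted_exp]) (use L t0 in auto)
  finally have "L * integral {a..t0} u \<le> L * (m * (e - 1) / (2 * L))"
    using L by (intro mult_left_mono) auto
  with ineq[OF t0] have "m * e \<le> \<delta> + L * (m * (e - 1) / (2 * L))"
    unfolding u_t0 by linarith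
  then have "m * e \<le> \<delta> + m * (e - 1) / 2" using L by simp
  then have me: "m * (e + 1) \<le> 2 * \<delta>" by (simp add: field_simps)
  have "m \<le> 2 * \<delta>"
  proof (cases "m \<le> 0")
    case False
    then have "m * 1 \<le> m * (e + 1)" using e1 by (intro mult_left_mono) auto
    with me show ?thesis by simp
  qed (use \<delta> in auto)
  then have "m * exp (2 * L * (t - a)) \<le> 2 * \<delta> * exp (2 * L * (t - a))" by simp
  with u_le[OF t] show ?thesis by linarith
qed

text \<open>
  The inhomogeneity \<open>g\<close> is only continuous: it collects the initial value and an integrated control.
  Banach's theorem applies on the whole interval at once because the integral operator is a
  contraction with factor \<open>1 / 2\<close> for the norm weighted by \<open>exp (- 2 L (t - a))\<close>. The weight is
  absorbed into the unknown (\<open>v = x / e\<close>), so that the ordinary sup norm can be used; functions on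
  \<open>[a, b]\<close> are extended to the line by freezing them outside.
\<close>
lemma picard_global:
  fixes H :: "real \<Rightarrow> 'a::euclidean_space \<Rightarrow> 'a"
  assumes ab: "a \<le> b" and L: "L > 0"
    and cont: "continuous_on ({a..b} \<times> UNIV) (\<lambda>(t, x). H t x)"
    and lip: "\<And>t x y. t \<in> {a..b} \<Longrightarrow> norm (H t x - H t y) \<le> L * norm (x - y)"
    and g: "continuous_on {a..b} g"
  obtains x where "continuous_on {a..b} x"
    "\<And>t. t \<in> {a..b} \<Longrightarrow> x t = g t + integral {a..t} (\<lambda>s. H s (x s))"
proof -
  define e where "e t = exp (2 * L * (t - a))" for t
  have e_pos: "e t > 0" for t by (simp add: e_def)
  have e_ne: "e t \<noteq> 0" for t by (simp add: e_def)
  have e_cont: "continuous_on S e" for S unfolding e_def by (intro continuous_intros)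
  define I where "I v t = g t + integral {a..t} (\<lambda>s. H s (e s *\<^sub>R v s))" for v t
  define J where "J v t = (1 / e t) *\<^sub>R I v t" for v t
  have H_cont: "continuous_on {a..b} (\<lambda>s. H s (e s *\<^sub>R v s))" if "continuous_on {a..b} v" for v
    using that by (intro continuous_on_compose2[OF cont, of _ "\<lambda>s. (s, e s *\<^sub>R v s)", simplified])
      (auto intro!: continuous_intros e_cont)
  have I_cont: "continuous_on {a..b} (I v)" if "continuous_on {a..b} v" for v
    unfolding I_def
    by (intro continuous_intros g indefinite_integral_continuous_1 integrable_continuous_real H_cont that)
  have J_cont: "continuous_on (cbox a b) (J v)" if "continuous_on {a..b} v" for v
    unfolding J_def using I_cont[OF that] by (auto intro!: continuous_intros e_cont simp: e_ne)
  have "\<exists>w :: real \<Rightarrow>\<^sub>C 'a. \<forall>t. apply_bcontfun w t = J (apply_bcontfun v) (clamp a b t)" for v :: "real \<Rightarrow>\<^sub>C 'a"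
    by (rule continuous_on_cbox_bcontfunE[OF J_cont[of "apply_bcontfun v"]]) auto
  then obtain \<Psi> :: "(real \<Rightarrow>\<^sub>C 'a) \<Rightarrow> (real \<Rightarrow>\<^sub>C 'a)"
    where \<Psi>: "\<And>v t. apply_bcontfun (\<Psi> v) t = J (apply_bcontfun v) (clamp a b t)" by metis
  have contr: "dist (\<Psi> v) (\<Psi> w) \<le> 1 / 2 * dist v w" for v w
  proof (rule dist_bound)
    fix t' :: real
    define t where "t = clamp a b t'"
    have t: "t \<in> {a..b}" using clamp_in_interval[of a b t'] ab by (simp add: t_def)
    have cv: "continuous_on {a..t} (\<lambda>s. H s (e s *\<^sub>R apply_bcontfun v s))" for v
      using t by (intro continuous_on_subset[OF H_cont]) auto
    have "norm (integral {a..t} (\<lambda>s. H s (e s *\<^sub>R v s) - H s (e s *\<^sub>R w s)))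
        \<le> integral {a..t} (\<lambda>s. L * dist v w * exp (2 * L * (s - a)))"
    proof (rule integral_norm_bound_integral)
      fix s assume s: "s \<in> {a..t}"
      then have "norm (H s (e s *\<^sub>R v s) - H s (e s *\<^sub>R w s)) \<le> L * norm (e s *\<^sub>R v s - e s *\<^sub>R w s)"
        using t by (intro lip) auto
      also have "\<dots> = L * (e s * dist (v s) (w s))"
        by (simp add: dist_norm e_pos[of s, THEN less_imp_le] flip: scaleR_diff_right)
      also have "\<dots> \<le> L * (e s * dist v w)"
        using L e_pos[of s] by (intro mult_left_mono dist_bounded) auto
      finally show "norm (H s (e s *\<^sub>R v s) - H s (e s *\<^sub>R w s)) \<le> L * dist v w * exp (2 * L * (s - a))"
        by (simp add: e_def mult_ac)
    qed (auto intro!: integrable_continuous_real continuous_intros cv)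
    also have "\<dots> = (L * dist v w) * (e t - 1) / (2 * L)"
      unfolding e_def by (rule integral_unique[OF integral_weighted_exp]) (use L t in auto)
    also have "\<dots> = dist v w * (e t - 1) / 2" using L by simp
    also have "\<dots> \<le> dist v w * e t / 2" by (simp add: algebra_simps)
    finally have le: "norm (integral {a..t} (\<lambda>s. H s (e s *\<^sub>R v s) - H s (e s *\<^sub>R w s))) \<le> dist v w * e t / 2" .
    have "I v t - I w t = integral {a..t} (\<lambda>s. H s (e s *\<^sub>R v s) - H s (e s *\<^sub>R w s))"
      unfolding I_def by (subst integral_diff) (auto intro!: integrable_continuous_real cv)
    with le have "norm (I v t - I w t) \<le> dist v w * e t / 2" by simp
    then have "norm (I v t - I w t) / e t \<le> 1 / 2 * dist v w"
      using e_pos[of t] by (simp add: pos_divide_le_eq mult_ac)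
    moreover have "J v t - J w t = (1 / e t) *\<^sub>R (I v t - I w t)"
      by (simp add: J_def scaleR_diff_right)
    ultimately have "norm (J v t - J w t) \<le> 1 / 2 * dist v w"
      using e_pos[of t] by simp
    then show "dist (\<Psi> v t') (\<Psi> w t') \<le> 1 / 2 * dist v w"
      by (simp add: \<Psi> t_def dist_norm)
  qed
  then obtain v where v: "\<Psi> v = v" using banach_fix_type[of "1/2" \<Psi>] by auto
  have v_eq: "v t = J v t" if "t \<in> {a..b}" for t
    using \<Psi>[of v t] v that by (simp add: clamp_cancel_cbox)
  define x where "x t = e t *\<^sub>R v t" for t
  show ?thesis
  proof
    show "continuous_on {a..b} x" unfolding x_def by (intro continuous_intros e_cont) auto
    fix t assume t: "t \<in> {a..b}"
    have "x t = I v t"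
      using v_eq[OF t] e_pos[of t] unfolding x_def J_def by simp
    then show "x t = g t + integral {a..t} (\<lambda>s. H s (x s))" by (simp add: I_def x_def)
  qed
qed

text \<open>
  A vector field that is defined and Lipschitz only in a tube around a curve \<open>c\<close> is made global by
  composing it with the nearest-point projection onto the ball of the tube. The solution \<open>x\<close> of the
  modified equation always exists; \<open>p\<close> is its projection, and \<open>x\<close> solves the original
  equation as long as an a priori estimate keeps it inside the tube. The last conclusion lets such
  an estimate be made before knowing this.
\<close>
lemma picard_in_tube:
  fixes H :: "real \<Rightarrow> 'a::euclidean_space \<Rightarrow> 'a"
  assumes ab: "a \<le> b" and L: "L > 0" and r: "r \<ge> 0"
    and cont: "continuous_on {(t, x). t \<in> {a..b} \<and> x \<in> cball (c t) r} (\<lambda>(t, x). H t x)"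
    and lip: "\<And>t x y. t \<in> {a..b} \<Longrightarrow> x \<in> cball (c t) r \<Longrightarrow> y \<in> cball (c t) r \<Longrightarrow>
                norm (H t x - H t y) \<le> L * norm (x - y)"
    and g: "continuous_on {a..b} g" and c: "continuous_on {a..b} c"
  obtains x p where "continuous_on {a..b} x" "continuous_on {a..b} p"
    "continuous_on {a..b} (\<lambda>s. H s (p s))"
    "\<And>t. t \<in> {a..b} \<Longrightarrow> x t = g t + integral {a..t} (\<lambda>s. H s (p s))"
    "\<And>t. p t \<in> cball (c t) r" "\<And>t. x t \<in> cball (c t) r \<Longrightarrow> p t = x t"
    "\<And>t. norm (p t - c t) \<le> norm (x t - c t)"
proof -
  define \<pi> :: "'a \<Rightarrow> 'a" where "\<pi> = closest_point (cball 0 r)"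
  have ne: "cball (0::'a) r \<noteq> {}" using r by auto
  have \<pi>_in: "\<pi> x \<in> cball 0 r" for x unfolding \<pi>_def by (rule closest_point_in_set) (use ne in auto)
  have \<pi>_lip: "norm (\<pi> x - \<pi> y) \<le> norm (x - y)" for x y
    unfolding \<pi>_def using closest_point_lipschitz[of "cball 0 r" x y] ne by (simp add: dist_norm)
  have \<pi>_id: "\<pi> x = x" if "x \<in> cball 0 r" for x
    unfolding \<pi>_def using that by (rule closest_point_self)
  have \<pi>_cont: "continuous_on S \<pi>" for S
    unfolding \<pi>_def by (rule continuous_on_closest_point) (use ne in auto)
  define P where "P t x = c t + \<pi> (x - c t)" for t x
  have P_in: "P t x \<in> cball (c t) r" for t x using \<pi>_in[of "x - c t"] by (simp add: P_def dist_norm)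
  have P_cont: "continuous_on ({a..b} \<times> UNIV) (\<lambda>z. P (fst z) (snd z))"
    unfolding P_def
    by (intro continuous_intros continuous_on_compose2[OF c] continuous_on_compose2[OF \<pi>_cont]) auto
  have cont': "continuous_on ({a..b} \<times> UNIV) (\<lambda>(s, y). H s (P s y))"
  proof -
    have "continuous_on ({a..b} \<times> UNIV) (\<lambda>z. (\<lambda>(t, x). H t x) (fst z, P (fst z) (snd z)))"
      by (rule continuous_on_compose2[OF cont]) (use P_in in \<open>auto intro!: continuous_intros P_cont\<close>)
    then show ?thesis by (simp add: case_prod_unfold)
  qed
  have lip': "norm (H t (P t y) - H t (P t z)) \<le> L * norm (y - z)" if t: "t \<in> {a..b}" for t y z
  proof -
    have "norm (H t (P t y) - H t (P t z)) \<le> L * norm (P t y - P t z)"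
      by (rule lip[OF t P_in P_in])
    also have "\<dots> \<le> L * norm (y - z)"
      using L \<pi>_lip[of "y - c t" "z - c t"] by (intro mult_left_mono) (auto simp: P_def)
    finally show ?thesis .
  qed
  obtain x where x: "continuous_on {a..b} x"
      "\<And>t. t \<in> {a..b} \<Longrightarrow> x t = g t + integral {a..t} (\<lambda>s. H s (P s (x s)))"
    using picard_global[OF ab L cont' lip' g] by blast
  have p_cont: "continuous_on {a..b} (\<lambda>t. P t (x t))"
    by (rule continuous_on_compose2[OF P_cont, of _ "\<lambda>t. (t, x t)", simplified])
      (auto intro!: continuous_intros x)
  have Hp_cont: "continuous_on {a..b} (\<lambda>t. H t (P t (x t)))"
    by (rule continuous_on_compose2[OF cont, of _ "\<lambda>t. (t, P t (x t))", simplified])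
      (use P_in in \<open>auto intro!: continuous_intros p_cont\<close>)
  show ?thesis
  proof (rule that[OF x(1) p_cont Hp_cont x(2) P_in])
    show "P t (x t) = x t" if "x t \<in> cball (c t) r" for t
      using that \<pi>_id[of "x t - c t"] by (simp add: P_def dist_norm norm_minus_commute)
    show "norm (P t (x t) - c t) \<le> norm (x t - c t)" for t
      using \<pi>_lip[of "x t - c t" 0] \<pi>_id[of 0] r by (simp add: P_def)
  qed
qed

section \<open>Compactly supported smooth controls\<close>

text \<open>
  For \<open>P = 1\<close> this is the standard smooth function that is flat at \<open>0\<close>. The polynomial factor
  makes the family closed under differentiation.
\<close>
definition flat_exp :: "real poly \<Rightarrow> real \<Rightarrow> real" where
  "flat_exp P x = (if x \<le> 0 then 0 else poly P (1 / x) * exp (- 1 / x))"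

lemma flat_exp_nonneg: "flat_exp 1 x \<ge> 0"
  by (simp add: flat_exp_def)

lemma poly_over_exp_tendsto_0: "((\<lambda>y::real. poly P y * exp (- y)) \<longlongrightarrow> 0) at_top"
proof -
  have "((\<lambda>y. \<Sum>i\<le>degree P. coeff P i * (y ^ i / exp y)) \<longlongrightarrow> (\<Sum>i\<le>degree P. coeff P i * 0)) at_top"
    by (intro tendsto_intros tendsto_power_div_exp_0)
  then show ?thesis
    by (simp add: poly_altdef sum_distrib_left exp_minus divide_inverse mult_ac)
qed

lemma flat_exp_tendsto_0: "(flat_exp P \<longlongrightarrow> 0) (at 0)"
proof -
  have "((\<lambda>x. poly P (inverse x) * exp (- inverse x)) \<longlongrightarrow> 0) (at_right (0::real))"
    by (rule filterlim_compose[OF poly_over_exp_tendsto_0 filterlim_inverse_at_top_right])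
  then have "(flat_exp P \<longlongrightarrow> 0) (at_right 0)"
    by (rule Lim_transform_eventually)
       (auto simp: flat_exp_def eventually_at_right_less divide_inverse
          intro!: eventually_mono[OF eventually_at_right_less])
  moreover have "(flat_exp P \<longlongrightarrow> 0) (at_left 0)"
    by (rule Lim_transform_eventually[OF tendsto_const])
       (auto simp: flat_exp_def eventually_at_left_field intro!: exI[of _ "-1"])
  ultimately show ?thesis by (simp add: filterlim_split_at)
qed

lemma flat_exp_has_derivative:
  "(flat_exp P has_real_derivative flat_exp ([:0, 0, 1:] * (P - pderiv P)) x) (at x)"
proof (cases x "0::real" rule: linorder_cases)
  case less
  have "((\<lambda>x. 0) has_real_derivative 0) (at x)" by simp
  then have "(flat_exp P has_real_derivative 0) (at x)"
    by (rule has_field_derivative_transform_within[where S = UNIV and d = "-x"]) (use less in \<open>auto simp: flat_exp_def dist_real_def\<close>)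
  then show ?thesis using less by (simp add: flat_exp_def)
next
  case equal
  have "((\<lambda>h. (flat_exp P h - flat_exp P 0) / (h - 0)) \<longlongrightarrow> 0) (at 0)"
  proof (rule Lim_transform_eventually[OF flat_exp_tendsto_0[of "[:0, 1:] * P"]])
    show "\<forall>\<^sub>F h in at 0. flat_exp ([:0, 1:] * P) h = (flat_exp P h - flat_exp P 0) / (h - 0)"
      by (rule eventually_at_topological[THEN iffD2]) (auto simp: flat_exp_def intro: exI[of _ UNIV])
  qed
  then show ?thesis using equal by (simp add: has_field_derivative_iff flat_exp_def)
next
  case greater
  have "((\<lambda>x. poly P (1 / x) * exp (- 1 / x)) has_real_derivative
      poly ([:0, 0, 1:] * (P - pderiv P)) (1 / x) * exp (- 1 / x)) (at x)"
    using greater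
    by (auto intro!: derivative_eq_intros DERIV_chain'[OF _ poly_DERIV]
        simp: field_simps power2_eq_square)
  then have "(flat_exp P has_real_derivative
      poly ([:0, 0, 1:] * (P - pderiv P)) (1 / x) * exp (- 1 / x)) (at x)"
    by (rule has_field_derivative_transform_within[where S = UNIV and d = x]) (use greater in \<open>auto simp: flat_exp_def dist_real_def\<close>)
  then show ?thesis using greater by (simp add: flat_exp_def)
qed

text \<open>
  A linear class of functions, closed under differentiation; its members are therefore smooth. The
  generators live on \<open>[a, b]\<close>, and the derivatives of the usual bump on that interval are sums of
  them.
\<close>
inductive_set smooth_bumps :: "(real \<Rightarrow> 'a::real_normed_vector) set" where
  base: "(\<lambda>t. (flat_exp P (t - a) * flat_exp Q (b - t)) *\<^sub>R v) \<in> smooth_bumps"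
| add: "f \<in> smooth_bumps \<Longrightarrow> g \<in> smooth_bumps \<Longrightarrow> (\<lambda>t. f t + g t) \<in> smooth_bumps"

lemma zero_smooth_bumps: "(\<lambda>_. 0) \<in> smooth_bumps"
  using smooth_bumps.base[where v = 0] by simp

lemma smooth_bumps_derivative:
  assumes "f \<in> smooth_bumps"
  shows "\<exists>f'\<in>smooth_bumps. \<forall>t. (f has_vector_derivative f' t) (at t)"
  using assms
proof induction
  case (base P a Q b v)
  define P' Q' where "P' = [:0, 0, 1:] * (P - pderiv P)" and "Q' = [:0, 0, 1:] * (Q - pderiv Q)"
  have dP: "((\<lambda>t. flat_exp P (t - a)) has_real_derivative flat_exp P' (t - a)) (at t)" for t
  proof -
    have "((\<lambda>t. t - a) has_real_derivative 1) (at t)" by (auto intro!: derivative_eq_intros)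
    from DERIV_chain2[OF flat_exp_has_derivative this] show ?thesis by (simp add: P'_def)
  qed
  have dQ: "((\<lambda>t. flat_exp Q (b - t)) has_real_derivative - flat_exp Q' (b - t)) (at t)" for t
  proof -
    have "((\<lambda>t. b - t) has_real_derivative - 1) (at t)" by (auto intro!: derivative_eq_intros)
    from DERIV_chain2[OF flat_exp_has_derivative this] show ?thesis by (simp add: Q'_def)
  qed
  have "((\<lambda>t. (flat_exp P (t - a) * flat_exp Q (b - t)) *\<^sub>R v) has_vector_derivative
      (flat_exp P' (t - a) * flat_exp Q (b - t)) *\<^sub>R v + (flat_exp P (t - a) * flat_exp Q' (b - t)) *\<^sub>R (- v)) (at t)"
    for t
    using has_vector_derivative_scaleR[OF DERIV_mult'[OF dP[of t] dQ[of t]] has_vector_derivative_const[of v]]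
    by (simp add: algebra_simps)
  then show ?case
    by (intro bexI[where x = "\<lambda>t. (flat_exp P' (t - a) * flat_exp Q (b - t)) *\<^sub>R v
          + (flat_exp P (t - a) * flat_exp Q' (b - t)) *\<^sub>R (- v)"] smooth_bumps.intros) auto
next
  case (add f g)
  then obtain f' g' where *: "f' \<in> smooth_bumps" "g' \<in> smooth_bumps"
    "\<And>t. (f has_vector_derivative f' t) (at t)" "\<And>t. (g has_vector_derivative g' t) (at t)" by blast
  then show ?case
    by (intro bexI[where x = "\<lambda>t. f' t + g' t"] smooth_bumps.add) (auto intro!: derivative_intros)
qed

lemma smooth_bumps_continuous: "f \<in> smooth_bumps \<Longrightarrow> continuous_on S f"
  using smooth_bumps_derivative[of f]
  by (meson continuous_at_imp_continuous_on has_vector_derivative_continuous)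

lemma smooth_bumps_iterated_derivative:
  assumes "f \<in> smooth_bumps"
  shows "((\<lambda>h t. vector_derivative h (at t)) ^^ k) f \<in> smooth_bumps"
proof (induction k)
  case (Suc k)
  obtain g where "g \<in> smooth_bumps"
    "\<And>t. (((\<lambda>h t. vector_derivative h (at t)) ^^ k) f has_vector_derivative g t) (at t)"
    using smooth_bumps_derivative[OF Suc.IH] by blast
  moreover from this have "(\<lambda>t. vector_derivative (((\<lambda>h t. vector_derivative h (at t)) ^^ k) f) (at t)) = g"
    by (intro ext vector_derivative_at)
  ultimately show ?case by simp
qed (use assms in simp)

lemma smooth_bumps_in_Cc_infinity:
  assumes f: "f \<in> smooth_bumps" and supp: "{t. f t \<noteq> 0} \<subseteq> {l..u}" and "a < l" "u < b"
  shows "f \<in> Cc_infinity a b"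
proof -
  have "((\<lambda>h t. vector_derivative h (at t)) ^^ k) f differentiable_on UNIV" for k
    using smooth_bumps_derivative[OF smooth_bumps_iterated_derivative[OF f, of k]]
    by (meson differentiable_at_imp_differentiable_on differentiableI_vector)
  moreover have cl: "closure {t. f t \<noteq> 0} \<subseteq> {l..u}"
    using supp by (rule closure_minimal) simp
  moreover have "{l..u} \<subseteq> {a<..<b}" using assms by auto
  moreover have "bounded {t. f t \<noteq> 0}" using supp bounded_closed_interval bounded_subset by blast
  ultimately show ?thesis unfolding Cc_infinity_def by auto
qed

lemma unit_mass_bump:
  assumes ab: "a < b"
  obtains \<beta> :: "real \<Rightarrow> real"
  where "\<And>v :: 'a::real_normed_vector. (\<lambda>t. \<beta> t *\<^sub>R v) \<in> smooth_bumps"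
    "continuous_on UNIV \<beta>" "\<And>t. \<beta> t \<ge> 0" "\<And>t. t \<notin> {a..b} \<Longrightarrow> \<beta> t = 0" "(\<beta> has_integral 1) {a..b}"
proof -
  define \<gamma> where "\<gamma> t = flat_exp 1 (t - a) * flat_exp 1 (b - t)" for t
  have "(\<lambda>t. \<gamma> t *\<^sub>R (1::real)) \<in> smooth_bumps"
    unfolding \<gamma>_def by (rule smooth_bumps.base)
  from smooth_bumps_continuous[OF this] have cont: "continuous_on S \<gamma>" for S by simp
  have nonneg: "\<gamma> t \<ge> 0" for t
    by (simp add: \<gamma>_def flat_exp_nonneg)
  define I where "I = integral {a..b} \<gamma>"
  have "\<gamma> ((a + b) / 2) \<noteq> 0" using ab by (simp add: \<gamma>_def flat_exp_def field_simps)
  moreover have "(a + b) / 2 \<in> {a..b}" using ab by simp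
  ultimately have "I \<noteq> 0"
    unfolding I_def using integral_eq_0_iff[OF cont ab nonneg] by blast
  moreover have "I \<ge> 0" unfolding I_def
    by (intro integral_nonneg integrable_continuous_real cont nonneg)
  ultimately have I: "I > 0" by simp
  show ?thesis
  proof
    show "(\<lambda>t. (\<gamma> t / I) *\<^sub>R v) \<in> smooth_bumps" for v :: 'a
      using smooth_bumps.base[of 1 a 1 b "(1 / I) *\<^sub>R v"] by (simp add: \<gamma>_def)
    show "continuous_on UNIV (\<lambda>t. \<gamma> t / I)" using I by (intro continuous_intros cont) auto
    show "\<gamma> t / I \<ge> 0" for t using I nonneg[of t] by simp
    show "\<gamma> t / I = 0" if "t \<notin> {a..b}" for t using that by (auto simp: \<gamma>_def flat_exp_def)
    have "(\<gamma> has_integral I) {a..b}"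
      unfolding I_def by (intro integrable_integral integrable_continuous_real cont)
    from has_integral_divide[OF this, of I] show "((\<lambda>t. \<gamma> t / I) has_integral 1) {a..b}" using I by simp
  qed
qed

text \<open>
  On a fine grid, the increment of \<open>h\<close> over each cell is reproduced by a bump of unit mass inside
  the cell, so that the primitive equals \<open>h t - h 0\<close> at the grid points and lies on a segment
  between consecutive values of \<open>h\<close> elsewhere. The induction is over the cells; strict support
  bounds keep room for the next bump and give compact support in the open interval.
\<close>
lemma approximate_by_integral_of_test_function:
  fixes h :: "real \<Rightarrow> 'a::euclidean_space"
  assumes T: "T > 0" and h: "continuous_on {0..T} h" and \<delta>: "\<delta> > 0"
  obtains \<zeta> where "\<zeta> \<in> Cc_infinity 0 T" "continuous_on UNIV \<zeta>"
    "\<And>t. t \<in> {0..T} \<Longrightarrow> norm (integral {0..t} \<zeta> - (h t - h 0)) \<le> \<delta>"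
proof -
  have "uniformly_continuous_on {0..T} h"
    by (rule compact_uniformly_continuous[OF h]) simp
  then obtain d where d: "d > 0"
    and mod: "\<And>s t. s \<in> {0..T} \<Longrightarrow> t \<in> {0..T} \<Longrightarrow> dist s t < d \<Longrightarrow> dist (h s) (h t) < \<delta> / 2"
    unfolding uniformly_continuous_on_def using \<delta> by (metis half_gt_zero)
  obtain n :: nat where n: "T / d < real n" using reals_Archimedean2 by blast
  have n0: "n > 0" using n T d by (metis divide_pos_pos gr0I of_nat_0 order.asym)
  define w where "w = T / real n"
  have w0: "w > 0" using T n0 by (simp add: w_def)
  have wd: "w < d" using n n0 d by (simp add: w_def field_simps)
  define \<tau> where "\<tau> k = real k * w" for k
  have \<tau>_Suc: "\<tau> (Suc k) = \<tau> k + w" for k by (simp add: \<tau>_def algebra_simps)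
  have "\<exists>\<zeta>\<in>smooth_bumps. \<exists>l u. 0 < l \<and> u < \<tau> k \<and> {t. \<zeta> t \<noteq> 0} \<subseteq> {l..u} \<and>
          integral {0..\<tau> k} \<zeta> = h (\<tau> k) - h 0 \<and>
          (\<forall>t\<in>{0..\<tau> k}. norm (integral {0..t} \<zeta> - (h t - h 0)) \<le> \<delta>)" if "k \<le> n" for k
    using that
  proof (induction k)
    case 0
    then show ?case
      by (intro bexI[OF _ zero_smooth_bumps] exI[of _ 1] exI[of _ "-1"]) (use \<delta> in \<open>auto simp: \<tau>_def\<close>)
  next
    case (Suc k)
    then obtain \<zeta> l u where \<zeta>: "\<zeta> \<in> smooth_bumps" "0 < l" "u < \<tau> k" "{t. \<zeta> t \<noteq> 0} \<subseteq> {l..u}"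
      "integral {0..\<tau> k} \<zeta> = h (\<tau> k) - h 0"
      "\<And>t. t \<in> {0..\<tau> k} \<Longrightarrow> norm (integral {0..t} \<zeta> - (h t - h 0)) \<le> \<delta>" by fastforce
    have \<tau>k: "0 \<le> \<tau> k" using w0 by (simp add: \<tau>_def)
    have "real (Suc k) * w \<le> real n * w" using Suc.prems w0 by (intro mult_right_mono) auto
    then have \<tau>T: "\<tau> (Suc k) \<le> T" using n0 by (simp add: \<tau>_def w_def)
    have \<tau>T': "\<tau> k \<le> T" using \<tau>T w0 unfolding \<tau>_Suc by linarith
    define a b where "a = \<tau> k + w / 3" and "b = \<tau> k + 2 * w / 3"
    have ab: "\<tau> k < a" "a < b" "b < \<tau> (Suc k)" using w0 by (auto simp: a_def b_def \<tau>_Suc)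
    obtain \<beta> :: "real \<Rightarrow> real" where \<beta>: "\<And>v :: 'a. (\<lambda>t. \<beta> t *\<^sub>R v) \<in> smooth_bumps" "continuous_on UNIV \<beta>"
      "\<And>t. \<beta> t \<ge> 0" "\<And>t. t \<notin> {a..b} \<Longrightarrow> \<beta> t = 0" "(\<beta> has_integral 1) {a..b}"
      using unit_mass_bump[OF ab(2)] by metis
    have \<beta>int: "\<beta> integrable_on {s..t}" for s t
      by (intro integrable_continuous_real continuous_on_subset[OF \<beta>(2)]) auto
    have \<zeta>int: "\<zeta> integrable_on {s..t}" for s t
      by (intro integrable_continuous_real smooth_bumps_continuous \<zeta>)
    have \<beta>1: "integral {0..\<tau> (Suc k)} \<beta> = 1"
      by (rule integral_unique, rule has_integral_on_superset[OF \<beta>(5,4)]) (use ab \<tau>k in auto)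
    define v where "v = h (\<tau> (Suc k)) - h (\<tau> k)"
    define \<zeta>' where "\<zeta>' t = \<zeta> t + \<beta> t *\<^sub>R v" for t
    have int: "integral {0..t} \<zeta>' = integral {0..t} \<zeta> + integral {0..t} \<beta> *\<^sub>R v" for t
    proof -
      have "((\<lambda>s. \<beta> s *\<^sub>R v) has_integral integral {0..t} \<beta> *\<^sub>R v) {0..t}"
        by (intro has_integral_scaleR_left integrable_integral \<beta>int)
      from has_integral_add[OF integrable_integral[OF \<zeta>int] this] show ?thesis
        unfolding \<zeta>'_def by (rule integral_unique)
    qed
    have \<zeta>late: "integral {0..t} \<zeta> = h (\<tau> k) - h 0" if "t \<ge> \<tau> k" for t
    proof (rule integral_unique, rule has_integral_on_superset)
      show "(\<zeta> has_integral h (\<tau> k) - h 0) {0..\<tau> k}" using \<zeta>(5) \<zeta>int integrable_integral by metis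
      show "\<zeta> x = 0" if "x \<notin> {0..\<tau> k}" for x
      proof (rule ccontr)
        assume "\<zeta> x \<noteq> 0"
        then have "x \<in> {l..u}" using \<zeta>(4) by auto
        with that \<zeta>(2,3) show False by auto
      qed
    qed (use that in auto)
    show ?case
    proof (rule bexI[of _ \<zeta>'], rule exI[of _ "min l a"], rule exI[of _ b], intro conjI ballI)
      show "\<zeta>' \<in> smooth_bumps" unfolding \<zeta>'_def by (intro smooth_bumps.add \<zeta> \<beta>)
      show "0 < min l a" "b < \<tau> (Suc k)" using \<zeta>(2) ab \<tau>k by auto
      have "{t. \<zeta>' t \<noteq> 0} \<subseteq> {t. \<zeta> t \<noteq> 0} \<union> {a..b}" using \<beta>(4) by (auto simp: \<zeta>'_def)
      also have "\<dots> \<subseteq> {l..u} \<union> {a..b}" using \<zeta>(4) by auto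
      also have "\<dots> \<subseteq> {min l a..b}" using \<zeta>(3) ab by auto
      finally show "{t. \<zeta>' t \<noteq> 0} \<subseteq> {min l a..b}" .
      show "integral {0..\<tau> (Suc k)} \<zeta>' = h (\<tau> (Suc k)) - h 0"
      proof -
        have "integral {0..\<tau> (Suc k)} \<zeta> = h (\<tau> k) - h 0" using w0 by (intro \<zeta>late) (simp add: \<tau>_Suc)
        then show ?thesis unfolding int \<beta>1 v_def by simp
      qed
      fix t assume t: "t \<in> {0..\<tau> (Suc k)}"
      show "norm (integral {0..t} \<zeta>' - (h t - h 0)) \<le> \<delta>"
      proof (cases "t \<le> \<tau> k")
        case True
        have "integral {0..t} \<beta> = integral {0..t} (\<lambda>_. 0)"
          by (rule integral_cong) (use True ab \<beta>(4) in auto)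
        then show ?thesis using \<zeta>(6)[of t] t True by (simp add: int)
      next
        case False
        define \<theta> where "\<theta> = integral {0..t} \<beta>"
        have "\<theta> \<le> integral {0..\<tau> (Suc k)} \<beta>"
          unfolding \<theta>_def by (rule integral_subset_le) (use t \<beta>int \<beta>(3) in auto)
        then have \<theta>: "\<theta> \<le> 1" "\<theta> \<ge> 0"
          using \<beta>1 \<beta>(3) \<beta>int by (auto simp: \<theta>_def intro!: integral_nonneg)
        have "norm (integral {0..t} \<zeta>' - (h t - h 0)) = norm (\<theta> *\<^sub>R v + (h (\<tau> k) - h t))"
        proof -
          have e: "integral {0..t} \<zeta> = h (\<tau> k) - h 0" using False by (intro \<zeta>late) simp
          show ?thesis unfolding int \<theta>_def e by (simp add: algebra_simps)
        qed
        also have "\<dots> \<le> \<theta> * norm v + norm (h (\<tau> k) - h t)"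
          using norm_triangle_ineq[of "\<theta> *\<^sub>R v" "h (\<tau> k) - h t"] \<theta> by simp
        also have "\<theta> * norm v \<le> 1 * norm v" using \<theta> by (intro mult_right_mono) auto
        also have "norm v \<le> \<delta> / 2"
          using mod[of "\<tau> (Suc k)" "\<tau> k"] \<tau>k \<tau>T \<tau>T' w0 wd by (auto simp: v_def dist_norm \<tau>_Suc)
        also have "norm (h (\<tau> k) - h t) \<le> \<delta> / 2"
          using mod[of "\<tau> k" t] \<tau>k \<tau>T \<tau>T' w0 wd t False by (auto simp: dist_norm \<tau>_Suc)
        finally show ?thesis by simp
      qed
    qed
  qed
  from this[of n] obtain \<zeta> l u where *: "\<zeta> \<in> smooth_bumps" "0 < l" "u < \<tau> n" "{t. \<zeta> t \<noteq> 0} \<subseteq> {l..u}"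
    "\<And>t. t \<in> {0..\<tau> n} \<Longrightarrow> norm (integral {0..t} \<zeta> - (h t - h 0)) \<le> \<delta>" by fastforce
  have "\<tau> n = T" using n0 by (simp add: \<tau>_def w_def)
  with * show ?thesis
    by (intro that[of \<zeta>] smooth_bumps_in_Cc_infinity smooth_bumps_continuous) auto
qed

section \<open>Configurations and their diagonals\<close>

lemma append_last_nth [simp]: "append_last y z $ Some i = y $ i" "append_last y z $ None = z"
  by (simp_all add: append_last_def)

lemma init_part_nth [simp]: "init_part x $ i = x $ Some i"
  by (simp add: init_part_def)

lemma init_part_append_last [simp]: "init_part (append_last y z) = y"
  by (simp add: vec_eq_iff)

lemma append_last_init_part [simp]: "append_last (init_part x) (x $ None) = x"
  unfolding vec_eq_iff by (metis append_last_nth init_part_nth not_Some_eq)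

lemma append_last_eqI: "init_part x = y \<Longrightarrow> x $ None = z \<Longrightarrow> append_last y z = x"
  by auto

lemma append_last_diff:
  fixes y y' :: "'a::real_normed_vector ^ 'n::finite"
  shows "append_last y z - append_last y' z' = append_last (y - y') (z - z')"
  unfolding vec_eq_iff
proof
  fix k show "(append_last y z - append_last y' z') $ k = append_last (y - y') (z - z') $ k"
    by (cases k) auto
qed

lemma init_part_diff: "init_part x - init_part y = init_part (x - y)"
  by (simp add: vec_eq_iff)

lemma norm_append_last_le: "norm (append_last y z) \<le> norm y + norm z"
  for y :: "'a::real_normed_vector ^ 'n::finite"
proof -
  have "(\<Sum>k\<in>UNIV. (norm (append_last y z $ k))\<^sup>2) = (norm z)\<^sup>2 + (\<Sum>i\<in>UNIV. (norm (y $ i))\<^sup>2)"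
    unfolding UNIV_option_conv by (subst sum.insert) (auto simp: sum.reindex)
  also have "(\<Sum>i\<in>UNIV. (norm (y $ i))\<^sup>2) = (norm y)\<^sup>2"
    by (simp add: norm_vec_def L2_set_def sum_nonneg)
  finally have "(norm (append_last y z))\<^sup>2 = (norm z)\<^sup>2 + (norm y)\<^sup>2"
    by (simp add: norm_vec_def[of "append_last y z"] L2_set_def sum_nonneg)
  also have "\<dots> \<le> (norm y + norm z)\<^sup>2" by (simp add: power2_sum)
  finally show ?thesis by (rule power2_le_imp_le) simp
qed

lemma norm_init_part_le: "norm (init_part x) \<le> norm x"
  for x :: "'a::real_normed_vector ^ 'n::finite option"
proof -
  have "(\<Sum>i\<in>UNIV. (norm (x $ Some i))\<^sup>2) \<le> (\<Sum>k\<in>UNIV. (norm (x $ k))\<^sup>2)"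
    unfolding UNIV_option_conv by (subst sum.insert) (auto simp: sum.reindex)
  then show ?thesis by (simp add: norm_vec_def L2_set_def)
qed

lemma norm_le_if_components_le:
  fixes x :: "'a::real_normed_vector ^ 'n::finite" and e :: real
  assumes "\<And>i. norm (x $ i) \<le> e"
  shows "norm x \<le> real CARD('n) * e"
proof -
  have "norm x \<le> (\<Sum>i\<in>UNIV. norm (x $ i))"
    by (simp add: norm_vec_def L2_set_le_sum)
  also have "\<dots> \<le> (\<Sum>i\<in>(UNIV :: 'n set). e)" by (intro sum_mono assms)
  finally show ?thesis by simp
qed

lemma continuous_on_append_last [continuous_intros]:
  fixes f :: "'a::topological_space \<Rightarrow> 'b::real_normed_vector ^ 'n::finite"
  assumes "continuous_on S f" "continuous_on S g"
  shows "continuous_on S (\<lambda>x. append_last (f x) (g x))"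
  unfolding append_last_def
proof (rule continuous_on_vec_lambda)
  fix k :: "'n option"
  show "continuous_on S (\<lambda>x. case k of None \<Rightarrow> g x | Some i \<Rightarrow> f x $ i)"
    by (cases k) (auto intro!: continuous_intros assms)
qed

lemma continuous_on_init_part [continuous_intros]:
  fixes f :: "'a::topological_space \<Rightarrow> 'b::real_normed_vector ^ 'n::finite option"
  assumes "continuous_on S f"
  shows "continuous_on S (\<lambda>x. init_part (f x))"
  unfolding init_part_def by (intro continuous_on_vec_lambda continuous_intros assms)

lemma closed_diagonals: "closed (diagonals :: ('a::real_normed_vector ^ 'n::finite) set)"
proof -
  have "diagonals = (\<Union>z\<in>{z. fst z \<noteq> snd z}. {x :: 'a ^ 'n. x $ fst z = x $ snd z})"
    unfolding diagonals_def by force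
  moreover have "closed (\<Union>z\<in>{z. fst z \<noteq> snd z}. {x :: 'a ^ 'n. x $ fst z = x $ snd z})"
    by (intro closed_UN ballI closed_Collect_eq continuous_intros) simp
  ultimately show ?thesis by (simp only:)
qed

lemma append_last_off_diagonals:
  "append_last y z \<notin> diagonals \<longleftrightarrow> y \<notin> diagonals \<and> (\<forall>i. y $ i \<noteq> z)"
proof
  assume off: "append_last y z \<notin> diagonals"
  have "y $ i \<noteq> y $ j" if "i \<noteq> j" for i j
    using off[unfolded diagonals_def, simplified, rule_format, of "Some i" "Some j"] that by simp
  moreover have "y $ i \<noteq> z" for i
    using off[unfolded diagonals_def, simplified, rule_format, of "Some i" None] by simp
  ultimately show "y \<notin> diagonals \<and> (\<forall>i. y $ i \<noteq> z)" unfolding diagonals_def by blast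
next
  assume off: "y \<notin> diagonals \<and> (\<forall>i. y $ i \<noteq> z)"
  have "append_last y z $ k \<noteq> append_last y z $ l" if "k \<noteq> l" for k l
    using that off by (cases k; cases l) (auto simp: diagonals_def)
  then show "append_last y z \<notin> diagonals" unfolding diagonals_def by blast
qed

lemma off_diagonals_iff:
  "x \<notin> diagonals \<longleftrightarrow> init_part x \<notin> diagonals \<and> (\<forall>i. x $ Some i \<noteq> x $ None)"
  using append_last_off_diagonals[of "init_part x" "x $ None"] by simp

lemma off_diagonalsD:
  assumes "x \<notin> diagonals"
  shows "init_part x \<notin> diagonals" "x $ Some i \<noteq> x $ None"
  using assms off_diagonals_iff by blast+

lemma norm_axis_vec [simp]: "norm (axis i v) = norm v"
  for v :: "'a::real_normed_vector"
proof -
  have "(\<Sum>j\<in>UNIV. (norm (axis i v $ j))\<^sup>2) = (\<Sum>j\<in>UNIV. if j = i then (norm v)\<^sup>2 else 0)"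
    by (rule sum.cong) (auto simp: axis_def)
  then show ?thesis unfolding norm_vec_def L2_set_def by simp
qed

section \<open>Lipschitz continuity on compact sets\<close>

text \<open>
  For open subsets of Euclidean spaces this is local Lipschitz continuity. Here all estimates take place on
  compact sets of configurations, and this form composes without any openness assumptions.
\<close>
definition compactly_lipschitz_on :: "'a::metric_space set \<Rightarrow> ('a \<Rightarrow> 'b::metric_space) \<Rightarrow> bool" where
  "compactly_lipschitz_on U g \<longleftrightarrow> (\<forall>S. compact S \<and> S \<subseteq> U \<longrightarrow> (\<exists>L. L-lipschitz_on S g))"

lemma compactly_lipschitz_onD:
  assumes "compactly_lipschitz_on U g" "compact S" "S \<subseteq> U"
  obtains L where "L > 0" "L-lipschitz_on S g"
proof -
  obtain L where "L-lipschitz_on S g" using assms unfolding compactly_lipschitz_on_def by blast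
  then have "(max L 1)-lipschitz_on S g" by (rule lipschitz_on_mono) auto
  then show ?thesis by (intro that[of "max L 1"]) auto
qed

lemma locally_lipschitz_on_imp_compactly:
  assumes "locally_lipschitz_on U g" shows "compactly_lipschitz_on U g"
  unfolding compactly_lipschitz_on_def
proof safe
  fix S assume S: "compact S" "S \<subseteq> U"
  have "local_lipschitz {0::real} S (\<lambda>_. g)"
    using assms unfolding locally_lipschitz_on_def by (rule local_lipschitz_subset) (use S in auto)
  then obtain L where "L-lipschitz_on S g"
    by (rule local_lipschitz_compact_implies_lipschitz) (use S in auto)
  then show "\<exists>L. L-lipschitz_on S g" by blast
qed

lemma lipschitz_imp_compactly_lipschitz: "L-lipschitz_on U g \<Longrightarrow> compactly_lipschitz_on U g"
  unfolding compactly_lipschitz_on_def using lipschitz_on_subset by blast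

lemma compactly_lipschitz_add:
  fixes g h :: "'a::metric_space \<Rightarrow> 'b::real_normed_vector"
  assumes "compactly_lipschitz_on U g" "compactly_lipschitz_on U h"
  shows "compactly_lipschitz_on U (\<lambda>x. g x + h x)"
  unfolding compactly_lipschitz_on_def
proof safe
  fix S assume S: "compact S" "S \<subseteq> U"
  obtain L where L: "L-lipschitz_on S g" using compactly_lipschitz_onD[OF assms(1) S] .
  obtain M where M: "M-lipschitz_on S h" using compactly_lipschitz_onD[OF assms(2) S] .
  from lipschitz_on_add[OF L M] show "\<exists>L. L-lipschitz_on S (\<lambda>x. g x + h x)" by blast
qed

lemma compactly_lipschitz_compose:
  assumes "compactly_lipschitz_on V h" "compactly_lipschitz_on U g" "g ` U \<subseteq> V"
  shows "compactly_lipschitz_on U (\<lambda>x. h (g x))"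
  unfolding compactly_lipschitz_on_def
proof safe
  fix S assume S: "compact S" "S \<subseteq> U"
  then obtain L where L: "L-lipschitz_on S g" using assms(2) unfolding compactly_lipschitz_on_def by blast
  have "compact (g ` S)" "g ` S \<subseteq> V"
    using lipschitz_on_continuous_on[OF L] S assms(3) by (auto intro: compact_continuous_image)
  then obtain M where "M-lipschitz_on (g ` S) h" using assms(1) unfolding compactly_lipschitz_on_def by blast
  from lipschitz_on_compose2[OF L this] show "\<exists>L. L-lipschitz_on S (\<lambda>x. h (g x))" by blast
qed

lemma compactly_lipschitz_cong:
  "compactly_lipschitz_on U g \<longleftrightarrow> compactly_lipschitz_on U h" if "\<And>x. x \<in> U \<Longrightarrow> g x = h x"
proof -
  have "L-lipschitz_on S g \<longleftrightarrow> L-lipschitz_on S h" if "S \<subseteq> U" for L S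
    by (rule lipschitz_on_cong) (use that \<open>\<And>x. x \<in> U \<Longrightarrow> g x = h x\<close> in auto)
  then show ?thesis unfolding compactly_lipschitz_on_def by blast
qed

lemma compactly_lipschitz_scaleR:
  fixes g :: "'a::metric_space \<Rightarrow> 'b::real_normed_vector" and \<alpha> :: "'a \<Rightarrow> real"
  assumes "compactly_lipschitz_on U \<alpha>" "compactly_lipschitz_on U g"
  shows "compactly_lipschitz_on U (\<lambda>x. \<alpha> x *\<^sub>R g x)"
  unfolding compactly_lipschitz_on_def
proof safe
  fix S assume S: "compact S" "S \<subseteq> U"
  obtain L where L: "L > 0" "L-lipschitz_on S \<alpha>" using compactly_lipschitz_onD[OF assms(1) S] .
  obtain M where M: "M > 0" "M-lipschitz_on S g" using compactly_lipschitz_onD[OF assms(2) S] .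
  obtain a where a: "\<And>x. x \<in> S \<Longrightarrow> norm (\<alpha> x) \<le> a" "a > 0"
    using compact_imp_bounded[OF compact_continuous_image[OF lipschitz_on_continuous_on[OF L(2)] S(1)]]
    unfolding bounded_pos by auto
  obtain b where b: "\<And>x. x \<in> S \<Longrightarrow> norm (g x) \<le> b" "b > 0"
    using compact_imp_bounded[OF compact_continuous_image[OF lipschitz_on_continuous_on[OF M(2)] S(1)]]
    unfolding bounded_pos by auto
  have "(a * M + L * b)-lipschitz_on S (\<lambda>x. \<alpha> x *\<^sub>R g x)"
  proof (rule lipschitz_onI)
    fix x y assume xy: "x \<in> S" "y \<in> S"
    have "dist (\<alpha> x *\<^sub>R g x) (\<alpha> y *\<^sub>R g y) = norm (\<alpha> x *\<^sub>R (g x - g y) + (\<alpha> x - \<alpha> y) *\<^sub>R g y)"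
      by (simp add: dist_norm algebra_simps)
    also have "\<dots> \<le> norm (\<alpha> x) * dist (g x) (g y) + dist (\<alpha> x) (\<alpha> y) * norm (g y)"
      by (rule norm_triangle_le) (simp add: dist_norm)
    also have "\<dots> \<le> a * (M * dist x y) + (L * dist x y) * b"
      using xy a b L M lipschitz_onD[OF L(2) xy] lipschitz_onD[OF M(2) xy]
      by (intro add_mono mult_mono) auto
    finally show "dist (\<alpha> x *\<^sub>R g x) (\<alpha> y *\<^sub>R g y) \<le> (a * M + L * b) * dist x y"
      by (simp add: algebra_simps)
  qed (use a b L M in auto)
  then show "\<exists>L. L-lipschitz_on S (\<lambda>x. \<alpha> x *\<^sub>R g x)" by blast
qed

lemma compactly_lipschitz_vec:
  fixes g :: "'a::metric_space \<Rightarrow> 'b::real_normed_vector ^ 'n::finite"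
  assumes "\<And>i. compactly_lipschitz_on U (\<lambda>x. g x $ i)"
  shows "compactly_lipschitz_on U g"
  unfolding compactly_lipschitz_on_def
proof safe
  fix S assume S: "compact S" "S \<subseteq> U"
  have "\<exists>L. L-lipschitz_on S (\<lambda>x. g x $ i)" for i
    using assms[of i] S unfolding compactly_lipschitz_on_def by blast
  then obtain L where L: "\<And>i. (L i)-lipschitz_on S (\<lambda>x. g x $ i)" by metis
  have "(\<Sum>i\<in>UNIV. L i)-lipschitz_on S g"
  proof (rule lipschitz_onI)
    fix x y assume xy: "x \<in> S" "y \<in> S"
    have "dist (g x) (g y) \<le> (\<Sum>i\<in>UNIV. norm ((g x - g y) $ i))"
      unfolding dist_norm norm_vec_def[of "g x - g y"] by (rule L2_set_le_sum) simp
    also have "\<dots> \<le> (\<Sum>i\<in>UNIV. L i * dist x y)"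
      using lipschitz_onD[OF L xy] by (intro sum_mono) (simp add: dist_norm)
    finally show "dist (g x) (g y) \<le> (\<Sum>i\<in>UNIV. L i) * dist x y" by (simp add: sum_distrib_right)
  qed (use lipschitz_on_nonneg[OF L] in \<open>auto intro: sum_nonneg\<close>)
  then show "\<exists>L. L-lipschitz_on S g" by blast
qed

text \<open>
  The derivative of the power function is bounded on the interval spanned by a compact set of
  positive numbers.
\<close>
lemma compactly_lipschitz_powr: "compactly_lipschitz_on {0<..} (\<lambda>s::real. s powr q)"
  unfolding compactly_lipschitz_on_def
proof safe
  fix S :: "real set" assume S: "compact S" "S \<subseteq> {0<..}"
  show "\<exists>L. L-lipschitz_on S (\<lambda>s. s powr q)"
  proof (cases "S = {}")
    case False
    obtain m where m: "m \<in> S" "\<And>s. s \<in> S \<Longrightarrow> m \<le> s" using compact_attains_inf[OF S(1) False] by blast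
    obtain M where M: "M \<in> S" "\<And>s. s \<in> S \<Longrightarrow> s \<le> M" using compact_attains_sup[OF S(1) False] by blast
    have m0: "m > 0" using m S by auto
    have "continuous_on {m..M} (\<lambda>s. q * s powr (q - 1))"
      using m0 by (intro continuous_intros) auto
    from compact_imp_bounded[OF compact_continuous_image[OF this]]
    obtain B where B: "B > 0" "\<And>s. s \<in> {m..M} \<Longrightarrow> norm (q * s powr (q - 1)) \<le> B"
      unfolding bounded_pos by auto
    have "B-lipschitz_on {m..M} (\<lambda>s. s powr q)"
    proof (rule lipschitz_onI)
      fix x y assume xy: "x \<in> {m..M}" "y \<in> {m..M}"
      have "norm (x powr q - y powr q) \<le> B * norm (x - y)"
      proof (rule field_differentiable_bound[of "{m..M}" "\<lambda>s. s powr q" "\<lambda>s. q * s powr (q - 1)"])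
        show "((\<lambda>s. s powr q) has_field_derivative q * z powr (q - 1)) (at z within {m..M})"
          if "z \<in> {m..M}" for z
          using that m0 by (intro DERIV_subset[OF has_real_derivative_powr]) auto
      qed (use xy B in auto)
      then show "dist (x powr q) (y powr q) \<le> B * dist x y" by (simp add: dist_norm)
    qed (use B in auto)
    then have "B-lipschitz_on S (\<lambda>s. s powr q)" by (rule lipschitz_on_subset) (use m M in auto)
    then show ?thesis by blast
  qed (auto intro: exI[of _ 0])
qed

section \<open>The driven particles as a control system whose control is a path\<close>

text \<open>
  The structural assumptions on the forces, with Lipschitz continuity in the form of
  bounds on compact sets, which is how every estimate uses it.
\<close>
locale driven_particles =
  fixes K :: "'n::finite \<Rightarrow> real ^ 'd \<Rightarrow> real ^ 'd"
    and F :: "'n option \<Rightarrow> (real ^ 'd) ^ ('n option) \<Rightarrow> real ^ 'd"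
    and F_tilde :: "'n \<Rightarrow> (real ^ 'd) ^ 'n \<Rightarrow> real ^ 'd"
    and F_hat :: "'n \<Rightarrow> (real ^ 'd) ^ ('n option) \<Rightarrow> real ^ 'd"
    and f :: "'n \<Rightarrow> real \<Rightarrow> real"
    and A :: "'n \<Rightarrow> real ^ 'd ^ 'd"
    and p :: "'n \<Rightarrow> real"
  assumes dim: "CARD('d) \<ge> 2"
    and F_cont: "\<And>k. continuous_on (- diagonals) (F k)"
    and K_cont: "\<And>i. continuous_on (- {0}) (K i)"
    and F_split: "\<And>i x. x \<notin> diagonals \<Longrightarrow> F (Some i) x = F_tilde i (init_part x) + F_hat i x"
    and F_tilde_lip: "\<And>i. compactly_lipschitz_on (- diagonals) (F_tilde i)"
    and F_hat_lip: "\<And>i. compactly_lipschitz_on UNIV (F_hat i)"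
    and F_last_lip: "compactly_lipschitz_on (- diagonals) (F None)"
    and K_eq: "\<And>i z. z \<noteq> 0 \<Longrightarrow> K i z = f i (norm z) *\<^sub>R ((A i *v z) /\<^sub>R (norm z powr p i))"
    and A_inv: "\<And>i. invertible (A i)"
    and f_lip: "\<And>i. \<exists>L. L-lipschitz_on {0..} (f i)"
    and f_0: "\<And>i. f i 0 \<noteq> 0"
    and p_gt_1: "\<And>i. p i > 1"
begin

definition driven_velocity :: "(real ^ 'd) ^ 'n option \<Rightarrow> (real ^ 'd) ^ 'n" where
  "driven_velocity x = (\<chi> j. K j (x $ Some j - x $ None) + F (Some j) x)"

lemma K_compactly_lipschitz: "compactly_lipschitz_on (- {0}) (K i)"
proof -
  obtain L where L: "L-lipschitz_on {0..} (f i)" using f_lip by blast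
  have n: "compactly_lipschitz_on (- {0}) (norm :: real ^ 'd \<Rightarrow> real)"
    by (rule lipschitz_imp_compactly_lipschitz[of 1])
       (auto intro!: lipschitz_onI simp: dist_norm norm_triangle_ineq3)
  have "compactly_lipschitz_on (- {0}) (\<lambda>z :: real ^ 'd. f i (norm z))"
    by (rule compactly_lipschitz_compose[OF lipschitz_imp_compactly_lipschitz[OF L] n]) auto
  moreover have "compactly_lipschitz_on (- {0}) (\<lambda>z :: real ^ 'd. norm z powr (- p i))"
    by (rule compactly_lipschitz_compose[OF compactly_lipschitz_powr n]) auto
  moreover have "compactly_lipschitz_on (- {0}) (\<lambda>z. A i *v z)"
  proof -
    have "bounded_linear (\<lambda>z. A i *v z)" by (rule matrix_vector_mul_bounded_linear)
    then obtain B where "B-lipschitz_on UNIV (\<lambda>z. A i *v z)" by (rule bounded_linear.lipschitz_boundE)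
    then show ?thesis by (intro lipschitz_imp_compactly_lipschitz) (rule lipschitz_on_subset, auto)
  qed
  ultimately have "compactly_lipschitz_on (- {0}) (\<lambda>z. f i (norm z) *\<^sub>R (norm z powr (- p i) *\<^sub>R (A i *v z)))"
    by (intro compactly_lipschitz_scaleR)
  then show ?thesis
    by (subst compactly_lipschitz_cong) (auto simp: K_eq powr_minus)
qed

lemma driven_velocity_compactly_lipschitz: "compactly_lipschitz_on (- diagonals) driven_velocity"
proof (rule compactly_lipschitz_vec)
  fix j
  have lin: "compactly_lipschitz_on (- diagonals) (\<lambda>x :: (real ^ 'd) ^ 'n option. x $ Some j - x $ None)"
  proof (rule lipschitz_imp_compactly_lipschitz[of 2], rule lipschitz_onI)
    fix x y :: "(real ^ 'd) ^ 'n option"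
    have "dist (x $ Some j - x $ None) (y $ Some j - y $ None) = norm ((x - y) $ Some j - (x - y) $ None)"
      by (simp add: dist_norm algebra_simps)
    also have "\<dots> \<le> norm ((x - y) $ Some j) + norm ((x - y) $ None)" by (rule norm_triangle_ineq4)
    also have "\<dots> \<le> 2 * norm (x - y)"
      using Finite_Cartesian_Product.norm_nth_le[of "x - y" "Some j"]
        Finite_Cartesian_Product.norm_nth_le[of "x - y" None] by linarith
    finally show "dist (x $ Some j - x $ None) (y $ Some j - y $ None) \<le> 2 * dist x y"
      by (simp add: dist_norm)
  qed simp
  have init: "compactly_lipschitz_on (- diagonals) (init_part :: (real ^ 'd) ^ 'n option \<Rightarrow> _)"
    by (rule lipschitz_imp_compactly_lipschitz[of 1])
       (auto intro!: lipschitz_onI simp: dist_norm init_part_diff norm_init_part_le)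
  have "compactly_lipschitz_on (- diagonals)
      (\<lambda>x. K j (x $ Some j - x $ None) + (F_tilde j (init_part x) + F_hat j x))"
    by (intro compactly_lipschitz_add compactly_lipschitz_compose[OF K_compactly_lipschitz lin]
          compactly_lipschitz_compose[OF F_tilde_lip init])
       (use F_hat_lip[of j] in \<open>auto simp: compactly_lipschitz_on_def dest: off_diagonalsD\<close>)
  then show "compactly_lipschitz_on (- diagonals) (\<lambda>x. driven_velocity x $ j)"
    by (subst compactly_lipschitz_cong) (auto simp: driven_velocity_def F_split)
qed

lemma driven_velocity_continuous: "continuous_on (- diagonals) driven_velocity"
  unfolding driven_velocity_def
proof (intro continuous_on_vec_lambda continuous_on_add F_cont)
  fix j
  show "continuous_on (- diagonals) (\<lambda>x :: (real ^ 'd) ^ 'n option. K j (x $ Some j - x $ None))"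
    by (rule continuous_on_compose2[OF K_cont])
       (auto intro!: continuous_intros simp: off_diagonals_iff)
qed

text \<open>
  The driven particles obey their equation along \<open>X\<close>, while the path of the controlled particle is
  only continuous and otherwise free. The integral form makes sense of the equation across the
  times at which pieces of a path are joined.
\<close>
definition driven :: "real \<Rightarrow> real \<Rightarrow> (real \<Rightarrow> (real ^ 'd) ^ 'n option) \<Rightarrow> bool" where
  "driven a b X \<longleftrightarrow> continuous_on {a..b} X \<and> (\<forall>t\<in>{a..b}. X t \<notin> diagonals) \<and>
     (\<forall>t\<in>{a..b}. init_part (X t) = init_part (X a) + integral {a..t} (\<lambda>s. driven_velocity (X s)))"

lemma drivenD:
  assumes "driven a b X"
  shows "continuous_on {a..b} X" "t \<in> {a..b} \<Longrightarrow> X t \<notin> diagonals"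
    "t \<in> {a..b} \<Longrightarrow> init_part (X t) = init_part (X a) + integral {a..t} (\<lambda>s. driven_velocity (X s))"
proof -
  note * = assms[unfolded driven_def]
  show "continuous_on {a..b} X" by (rule *[THEN conjunct1])
  show "t \<in> {a..b} \<Longrightarrow> X t \<notin> diagonals" by (rule *[THEN conjunct2, THEN conjunct1, THEN bspec])
  show "t \<in> {a..b} \<Longrightarrow> init_part (X t) = init_part (X a) + integral {a..t} (\<lambda>s. driven_velocity (X s))"
    by (rule *[THEN conjunct2, THEN conjunct2, THEN bspec])
qed

lemma driven_concat:
  assumes X: "driven a b X" and Y: "driven b c Y" and XY: "X b = Y b" and ab: "a \<le> b" "b \<le> c"
  defines "Z \<equiv> \<lambda>t. if t \<le> b then X t else Y t"
  shows "driven a c Z"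
  unfolding driven_def
proof (intro conjI ballI)
  have ZX: "Z t = X t" if "t \<in> {a..b}" for t using that by (simp add: Z_def)
  have ZY: "Z t = Y t" if "t \<in> {b..c}" for t using that XY by (auto simp: Z_def)
  have un: "{a..c} = {a..b} \<union> {b..c}" using ab by auto
  show cont: "continuous_on {a..c} Z"
    unfolding un
  proof (rule continuous_on_closed_Un)
    show "continuous_on {a..b} Z" using ZX by (intro continuous_on_eq[OF drivenD(1)[OF X]]) simp
    show "continuous_on {b..c} Z" using ZY by (intro continuous_on_eq[OF drivenD(1)[OF Y]]) simp
  qed auto
  show off: "Z t \<notin> diagonals" if "t \<in> {a..c}" for t
    using that drivenD(2)[OF X] drivenD(2)[OF Y] by (auto simp: Z_def)
  have vcont: "continuous_on {a..c} (\<lambda>s. driven_velocity (Z s))"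
    by (rule continuous_on_compose2[OF driven_velocity_continuous cont]) (use off in auto)
  fix t assume t: "t \<in> {a..c}"
  show "init_part (Z t) = init_part (Z a) + integral {a..t} (\<lambda>s. driven_velocity (Z s))"
  proof (cases "t \<le> b")
    case True
    have "integral {a..t} (\<lambda>s. driven_velocity (Z s)) = integral {a..t} (\<lambda>s. driven_velocity (X s))"
      by (rule integral_cong) (use True in \<open>auto simp: Z_def\<close>)
    then show ?thesis using drivenD(3)[OF X, of t] True t ab by (simp add: Z_def)
  next
    case False
    have "integral {a..b} (\<lambda>s. driven_velocity (Z s)) + integral {b..t} (\<lambda>s. driven_velocity (Z s)) = integral {a..t} (\<lambda>s. driven_velocity (Z s))"
      by (rule Henstock_Kurzweil_Integration.integral_combine)
         (use False t ab in \<open>auto intro!: integrable_continuous_real continuous_on_subset[OF vcont]\<close>)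
    moreover have "integral {a..b} (\<lambda>s. driven_velocity (Z s)) = integral {a..b} (\<lambda>s. driven_velocity (X s))"
      by (rule integral_cong) (use ZX in auto)
    moreover have "integral {b..t} (\<lambda>s. driven_velocity (Z s)) = integral {b..t} (\<lambda>s. driven_velocity (Y s))"
      by (rule integral_cong) (use ZY t in auto)
    moreover have "init_part (X b) = init_part (X a) + integral {a..b} (\<lambda>s. driven_velocity (X s))"
      using drivenD(3)[OF X, of b] ab by simp
    moreover have "init_part (Y t) = init_part (Y b) + integral {b..t} (\<lambda>s. driven_velocity (Y s))"
      using drivenD(3)[OF Y, of t] False t by simp
    ultimately have "init_part (Y t) = init_part (X a) + integral {a..t} (\<lambda>s. driven_velocity (Z s))"
      unfolding XY[symmetric] by (simp only: add.assoc)
    then show ?thesis using False ab by (simp add: Z_def)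
  qed
qed

text \<open>
  The controlled particle is tied to particle \<open>i\<close> at the prescribed offset \<open>u\<close>. This eliminates it
  and leaves an equation for the driven particles alone, which is regular wherever they stay near
  the reference motion \<open>y0 + (t - a) v\<close>. The feedback is essential: particle \<open>i\<close> may move fast
  while its distance to the controlled particle remains under exact control.
\<close>
lemma steer_at_prescribed_offset:
  assumes ab: "a \<le> b" and u: "continuous_on {a..b} u" and r: "B * (b - a) \<le> r" and B: "B \<ge> 0"
    and off: "\<And>t y. t \<in> {a..b} \<Longrightarrow> norm (y - (y0 + (t - a) *\<^sub>R v)) \<le> r \<Longrightarrow>
               append_last y (y $ i - u t) \<notin> diagonals"
    and bd: "\<And>t y. t \<in> {a..b} \<Longrightarrow> norm (y - (y0 + (t - a) *\<^sub>R v)) \<le> r \<Longrightarrow>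
               norm (driven_velocity (append_last y (y $ i - u t)) - v) \<le> B"
  obtains X where "driven a b X" "init_part (X a) = y0"
    "\<And>t. X t $ None = X t $ Some i - u t"
    "\<And>t. t \<in> {a..b} \<Longrightarrow> norm (init_part (X t) - (y0 + (t - a) *\<^sub>R v)) \<le> B * (t - a)"
proof -
  define ref where "ref t = y0 + (t - a) *\<^sub>R v" for t
  define e where "e t y = append_last y (y $ i - u t)" for t y
  have r0: "r \<ge> 0" using r B ab by (meson diff_ge_0_iff_ge mult_nonneg_nonneg order_trans)
  define D where "D = {(t, y). t \<in> {a..b} \<and> y \<in> cball (ref t) r}"
  have D_eq: "D = (\<lambda>(t, y). (t, ref t + y)) ` ({a..b} \<times> cball 0 r)"
  proof
    show "D \<subseteq> (\<lambda>(t, y). (t, ref t + y)) ` ({a..b} \<times> cball 0 r)"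
    proof
      fix z assume "z \<in> D"
      then show "z \<in> (\<lambda>(t, y). (t, ref t + y)) ` ({a..b} \<times> cball 0 r)"
        by (intro image_eqI[of _ _ "(fst z, snd z - ref (fst z))"])
           (auto simp: D_def dist_norm norm_minus_commute)
    qed
  qed (auto simp: D_def dist_norm)
  have "compact D"
    unfolding D_eq ref_def
    by (intro compact_continuous_image compact_Times) (auto intro!: continuous_intros simp: split_beta)
  have e_cont: "continuous_on D (\<lambda>z. e (fst z) (snd z))"
    unfolding e_def by (intro continuous_intros continuous_on_compose2[OF u]) (auto simp: D_def)
  define E where "E = (\<lambda>z. e (fst z) (snd z)) ` D"
  have E: "compact E" unfolding E_def by (rule compact_continuous_image[OF e_cont \<open>compact D\<close>])
  have E_off: "E \<subseteq> - diagonals"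
    using off by (auto simp: E_def D_def e_def ref_def dist_norm norm_minus_commute)
  obtain L where L: "L > 0" "L-lipschitz_on E driven_velocity"
    using compactly_lipschitz_onD[OF driven_velocity_compactly_lipschitz E E_off] .
  have inE: "e t y \<in> E" if "t \<in> {a..b}" "y \<in> cball (ref t) r" for t y
    unfolding E_def by (rule image_eqI[of _ _ "(t, y)"]) (use that in \<open>auto simp: D_def\<close>)
  have lip: "norm (driven_velocity (e t y) - driven_velocity (e t z)) \<le> (L * 2) * norm (y - z)"
    if "t \<in> {a..b}" "y \<in> cball (ref t) r" "z \<in> cball (ref t) r" for t y z
  proof -
    have "norm (driven_velocity (e t y) - driven_velocity (e t z)) \<le> L * norm (e t y - e t z)"
      using lipschitz_onD[OF L(2) inE[OF that(1,2)] inE[OF that(1,3)]] by (simp add: dist_norm)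
    also have "norm (e t y - e t z) \<le> norm (y - z) + norm ((y - z) $ i)"
      using norm_append_last_le[of "y - z" "(y - z) $ i"] by (simp add: e_def append_last_diff)
    also have "\<dots> \<le> 2 * norm (y - z)"
      using Finite_Cartesian_Product.norm_nth_le[of "y - z" i] by simp
    finally show ?thesis using L by simp
  qed
  have cont: "continuous_on D (\<lambda>(t, y). driven_velocity (e t y))"
    unfolding split_beta
    by (rule continuous_on_compose2[OF driven_velocity_continuous e_cont]) (use E_off in \<open>auto simp: E_def\<close>)
  obtain x q where x: "continuous_on {a..b} x" "continuous_on {a..b} (\<lambda>s. driven_velocity (e s (q s)))"
    "\<And>t. t \<in> {a..b} \<Longrightarrow> x t = y0 + integral {a..t} (\<lambda>s. driven_velocity (e s (q s)))"
    "\<And>t. q t \<in> cball (ref t) r" "\<And>t. x t \<in> cball (ref t) r \<Longrightarrow> q t = x t"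
    by (rule picard_in_tube[where H = "\<lambda>t y. driven_velocity (e t y)" and c = ref and L = "L * 2" and g = "\<lambda>_. y0",
          OF ab _ r0 cont[unfolded D_def] lip])
       (use L in \<open>auto intro!: continuous_intros simp: ref_def\<close>)
  have dev: "norm (x t - ref t) \<le> B * (t - a)" if t: "t \<in> {a..b}" for t
  proof -
    have "x t - ref t = integral {a..t} (\<lambda>s. driven_velocity (e s (q s))) - integral {a..t} (\<lambda>s. v)"
      using x(3)[OF t] t by (simp add: ref_def)
    also have "\<dots> = integral {a..t} (\<lambda>s. driven_velocity (e s (q s)) - v)"
      by (subst integral_diff)
         (use t in \<open>auto intro!: integrable_continuous_real continuous_on_subset[OF x(2)]\<close>)
    also have "norm \<dots> \<le> integral {a..t} (\<lambda>s. B)"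
    proof (rule integral_norm_bound_integral)
      show "norm (driven_velocity (e s (q s)) - v) \<le> B" if "s \<in> {a..t}" for s
        using bd[of s "q s"] x(4)[of s] that t
        by (auto simp: e_def ref_def dist_norm norm_minus_commute)
    qed (use t in \<open>auto intro!: integrable_continuous_real continuous_intros continuous_on_subset[OF x(2)]\<close>)
    also have "\<dots> = B * (t - a)" using t by simp
    finally show ?thesis .
  qed
  have tube: "x t \<in> cball (ref t) r" if t: "t \<in> {a..b}" for t
  proof -
    have "B * (t - a) \<le> B * (b - a)" using t B by (intro mult_left_mono) auto
    with dev[OF t] r show ?thesis by (simp add: dist_norm norm_minus_commute)
  qed
  show ?thesis
  proof (rule that[of "\<lambda>t. e t (x t)"])
    show "driven a b (\<lambda>t. e t (x t))"
      unfolding driven_def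
    proof (intro conjI ballI)
      show "continuous_on {a..b} (\<lambda>t. e t (x t))"
        unfolding e_def by (intro continuous_intros x u)
      fix t assume t: "t \<in> {a..b}"
      show "e t (x t) \<notin> diagonals" using inE[OF t tube[OF t]] E_off by auto
      have "integral {a..t} (\<lambda>s. driven_velocity (e s (q s))) = integral {a..t} (\<lambda>s. driven_velocity (e s (x s)))"
        by (rule integral_cong) (use x(5) tube t in auto)
      then show "init_part (e t (x t)) = init_part (e a (x a)) + integral {a..t} (\<lambda>s. driven_velocity (e s (x s)))"
        using x(3)[of t] x(3)[of a] t ab by (simp add: e_def)
    qed
    show "init_part (e a (x a)) = y0" using x(3)[of a] ab by (simp add: e_def)
  qed (use dev in \<open>auto simp: e_def ref_def\<close>)
qed

end

section \<open>Moving the controlled particle and pushing a driven one\<close>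

context driven_particles
begin

text \<open>
  The controlled particle follows a path from its position to \<open>z1\<close> that misses all driven
  particles. The forces met on the way are bounded by some \<open>B\<close> that depends on the path only, so a
  duration small compared with \<open>1 / B\<close> leaves the driven particles almost where they were. The path is
  followed relative to particle \<open>i\<close>, so that the final offset to that particle is attained
  exactly.
\<close>
lemma relocate_controlled_particle:
  assumes off0: "x0 \<notin> diagonals" and off1: "append_last (init_part x0) z1 \<notin> diagonals"
    and \<kappa>: "\<kappa> > 0" and \<tau>0: "\<tau>0 > 0"
  obtains \<tau> X where "0 < \<tau>" "\<tau> < \<tau>0" "driven a (a + \<tau>) X" "X a = x0"
    "\<And>t. t \<in> {a..a + \<tau>} \<Longrightarrow> norm (init_part (X t) - init_part x0) \<le> \<kappa>"
    "X (a + \<tau>) $ None = X (a + \<tau>) $ Some i + (z1 - x0 $ Some i)"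
proof -
  define y0 where "y0 = init_part x0"
  \<comment> \<open>The path has to avoid the finitely many positions of the driven particles at the start.\<close>
  define S where "S = range (\<lambda>j. y0 $ j)"
  have "path_connected (- S)"
    by (rule path_connected_complement_countable) (use dim in \<open>auto simp: S_def intro: countable_finite\<close>)
  moreover have "x0 $ None \<in> - S" "z1 \<in> - S"
    using off0 off1 by (auto simp: S_def y0_def append_last_off_diagonals off_diagonals_iff[of x0])
  ultimately obtain \<gamma> where \<gamma>: "path \<gamma>" "path_image \<gamma> \<subseteq> - S" "pathstart \<gamma> = x0 $ None" "pathfinish \<gamma> = z1"
    unfolding path_connected_def by blast
  have \<gamma>_cont: "continuous_on {0..1} \<gamma>" using \<gamma>(1) by (simp add: path_def)
  define C where "C = (\<lambda>s. append_last y0 (\<gamma> s)) ` {0..1}"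
  have C: "compact C" "C \<noteq> {}"
    unfolding C_def by (auto intro!: compact_continuous_image continuous_intros \<gamma>_cont)
  have "y0 \<notin> diagonals" using off0 by (simp add: y0_def off_diagonals_iff)
  then have "append_last y0 (\<gamma> s) \<notin> diagonals" if "s \<in> {0..1}" for s
    using \<gamma>(2) that unfolding append_last_off_diagonals S_def path_image_def by blast
  then have "C \<subseteq> - diagonals" by (auto simp: C_def)
  then obtain e where e: "e > 0" "{x. infdist x C \<le> e} \<subseteq> - diagonals"
    using compact_in_open_separated[OF C(2,1)] closed_diagonals by (metis open_Compl)
  \<comment> \<open>The driven particles will not be exactly at rest, so room is needed around the path.\<close>
  define N where "N = {x. infdist x C \<le> e}"
  have "compact N" unfolding N_def by (rule compact_infdist_le) (use C e in auto)
  then have "compact (driven_velocity ` N)"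
    by (intro compact_continuous_image continuous_on_subset[OF driven_velocity_continuous])
       (use e in \<open>auto simp: N_def\<close>)
  from compact_imp_bounded[OF this]
  obtain B where B: "B > 0" "\<And>x. x \<in> N \<Longrightarrow> norm (driven_velocity x) \<le> B"
    unfolding bounded_pos by auto
  define r where "r = min \<kappa> (e / 2)"
  define \<tau> where "\<tau> = min (\<tau>0 / 2) (r / B)"
  have r: "r > 0" "r \<le> \<kappa>" "2 * r \<le> e" using \<kappa> e by (auto simp: r_def)
  have \<tau>: "\<tau> > 0" "\<tau> < \<tau>0" using \<tau>0 r B by (auto simp: \<tau>_def)
  have "B * \<tau> \<le> B * (r / B)" using B by (intro mult_left_mono) (auto simp: \<tau>_def)
  then have B\<tau>: "B * \<tau> \<le> r" using B by simp
  define u where "u t = y0 $ i - \<gamma> ((t - a) / \<tau>)" for t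
  have inN: "append_last y (y $ i - u t) \<in> N" if t: "t \<in> {a..a + \<tau>}" and y: "norm (y - y0) \<le> r" for t y
  proof -
    define s where "s = (t - a) / \<tau>"
    have "s \<in> {0..1}" using t \<tau> by (auto simp: s_def)
    then have "append_last y0 (\<gamma> s) \<in> C" by (auto simp: C_def)
    then have "infdist (append_last y (y $ i - u t)) C \<le> dist (append_last y (y $ i - u t)) (append_last y0 (\<gamma> s))"
      by (rule infdist_le)
    also have "\<dots> = norm (append_last (y - y0) ((y - y0) $ i))"
      by (simp add: dist_norm append_last_diff u_def s_def algebra_simps)
    also have "\<dots> \<le> norm (y - y0) + norm ((y - y0) $ i)" by (rule norm_append_last_le)
    also have "\<dots> \<le> e" using y r Finite_Cartesian_Product.norm_nth_le[of "y - y0" i] by linarith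
    finally show ?thesis by (simp add: N_def)
  qed
  obtain X where X: "driven a (a + \<tau>) X" "init_part (X a) = y0" "\<And>t. X t $ None = X t $ Some i - u t"
    "\<And>t. t \<in> {a..a + \<tau>} \<Longrightarrow> norm (init_part (X t) - (y0 + (t - a) *\<^sub>R 0)) \<le> B * (t - a)"
  proof (rule steer_at_prescribed_offset[of a "a + \<tau>" u B r y0 0 i])
    show "continuous_on {a..a + \<tau>} u"
      unfolding u_def
      by (intro continuous_intros continuous_on_compose2[OF \<gamma>_cont]) (use \<tau> in \<open>auto simp: field_simps\<close>)
    fix t y assume t: "t \<in> {a..a + \<tau>}" and "norm (y - (y0 + (t - a) *\<^sub>R 0)) \<le> r"
    then have "append_last y (y $ i - u t) \<in> N" using inN by simp
    then show "append_last y (y $ i - u t) \<notin> diagonals" "norm (driven_velocity (append_last y (y $ i - u t)) - 0) \<le> B"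
      using e(2) B(2) unfolding N_def by auto
  qed (use \<tau> B B\<tau> in auto)
  show ?thesis
  proof (rule that[OF \<tau> X(1)])
    have "X a $ Some i = y0 $ i" by (simp flip: X(2))
    moreover have "X a = append_last (init_part (X a)) (X a $ None)" by simp
    ultimately have "X a = append_last y0 (x0 $ None)"
      using X(3)[of a] \<gamma>(3) by (simp add: X(2) u_def pathstart_def)
    then show "X a = x0" by (simp add: y0_def)
    show "norm (init_part (X t) - init_part x0) \<le> \<kappa>" if t: "t \<in> {a..a + \<tau>}" for t
    proof -
      have "norm (init_part (X t) - init_part x0) \<le> B * (t - a)" using X(4)[OF t] by (simp add: y0_def)
      also have "\<dots> \<le> B * \<tau>" using t B by (intro mult_left_mono) auto
      finally show ?thesis using B\<tau> r by simp
    qed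
    show "X (a + \<tau>) $ None = X (a + \<tau>) $ Some i + (z1 - x0 $ Some i)"
      using X(3)[of "a + \<tau>"] \<tau> \<gamma>(4) by (simp add: u_def pathfinish_def y0_def)
  qed
qed

text \<open>
  Relocation takes an unspecified short time \<open>\<tau>\<close> out of \<open>[a, a + d]\<close>; in the remaining time the
  offset \<open>w\<close> is kept and the driven particles move with velocity approximately \<open>v\<close>. Since \<open>\<tau>\<close> is
  small compared with \<open>\<mu> / norm v\<close>, starting the motion late costs nothing that \<open>\<mu>\<close> does not
  cover, and the reference motion can be taken from time \<open>a\<close> on.
\<close>
lemma relocate_then_drive:
  assumes x0: "x0 \<notin> diagonals" and d: "d > 0" and \<mu>: "\<mu> > 0" and B: "B \<ge> 0" "B * d \<le> \<mu> / 2"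
    and off: "\<And>t y. t \<in> {0..d} \<Longrightarrow> norm (y - (init_part x0 + t *\<^sub>R v)) \<le> \<mu> \<Longrightarrow>
               append_last y (y $ i - w) \<notin> diagonals"
    and bd: "\<And>t y. t \<in> {0..d} \<Longrightarrow> norm (y - (init_part x0 + t *\<^sub>R v)) \<le> \<mu> \<Longrightarrow>
               norm (driven_velocity (append_last y (y $ i - w)) - v) \<le> B"
  obtains X where "driven a (a + d) X" "X a = x0"
    "\<And>t. t \<in> {a..a + d} \<Longrightarrow> norm (init_part (X t) - (init_part x0 + (t - a) *\<^sub>R v)) \<le> \<mu>"
    "X (a + d) $ None = X (a + d) $ Some i - w"
proof -
  define y0 where "y0 = init_part x0"
  define \<tau>0 where "\<tau>0 = min d (\<mu> / (4 * (norm v + 1)))"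
  have nv: "norm v + 1 > 0" by (simp add: add_nonneg_pos)
  have \<tau>0: "\<tau>0 > 0" using d \<mu> nv by (simp add: \<tau>0_def)
  have off1: "append_last (init_part x0) (x0 $ Some i - w) \<notin> diagonals"
    using off[of 0 y0] d \<mu> by (simp add: y0_def)
  obtain \<tau> X1 where \<tau>: "0 < \<tau>" "\<tau> < \<tau>0" and X1: "driven a (a + \<tau>) X1" "X1 a = x0"
    "\<And>t. t \<in> {a..a + \<tau>} \<Longrightarrow> norm (init_part (X1 t) - init_part x0) \<le> \<mu> / 4"
    "X1 (a + \<tau>) $ None = X1 (a + \<tau>) $ Some i + (x0 $ Some i - w - x0 $ Some i)"
    using relocate_controlled_particle[OF x0 off1, of "\<mu> / 4" \<tau>0 a i thesis] \<mu> \<tau>0 by auto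
  have \<tau>d: "\<tau> < d" using \<tau> by (simp add: \<tau>0_def)
  have "\<tau> * (norm v + 1) \<le> (\<mu> / (4 * (norm v + 1))) * (norm v + 1)"
    using \<tau> nv by (intro mult_right_mono) (auto simp: \<tau>0_def)
  also have "\<dots> = \<mu> / 4"
    using nonzero_mult_divide_mult_cancel_right[of "norm v + 1" \<mu> 4] nv by (simp only: times_divide_eq_left)
  finally have \<tau>v: "\<tau> * norm v \<le> \<mu> / 4" using \<tau> by (simp add: distrib_left)
  have early: "norm (init_part (X1 t) - (y0 + (t - a) *\<^sub>R v)) \<le> \<mu> / 2" if t: "t \<in> {a..a + \<tau>}" for t
  proof -
    have "norm (init_part (X1 t) - (y0 + (t - a) *\<^sub>R v)) = norm ((init_part (X1 t) - y0) - (t - a) *\<^sub>R v)"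
      by (simp add: algebra_simps)
    also have "\<dots> \<le> norm (init_part (X1 t) - y0) + norm ((t - a) *\<^sub>R v)" by (rule norm_triangle_ineq4)
    also have "norm ((t - a) *\<^sub>R v) \<le> \<tau> * norm v" using t by (simp add: mult_right_mono)
    finally show ?thesis using X1(3)[OF t] \<tau>v by (simp add: y0_def)
  qed
  define y1 where "y1 = init_part (X1 (a + \<tau>))"
  have y1: "norm (y1 - (y0 + \<tau> *\<^sub>R v)) \<le> \<mu> / 2" using early[of "a + \<tau>"] \<tau> by (simp add: y1_def)
  have near: "norm (y - (y0 + (t - a) *\<^sub>R v)) \<le> \<mu>"
    if "norm (y - (y1 + (t - (a + \<tau>)) *\<^sub>R v)) \<le> \<mu> / 2" for t y
  proof -
    have e: "y - (y0 + (t - a) *\<^sub>R v) = (y - (y1 + (t - (a + \<tau>)) *\<^sub>R v)) + (y1 - (y0 + \<tau> *\<^sub>R v))"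
      by (simp add: algebra_simps)
    show ?thesis unfolding e using norm_triangle_mono[OF that y1] by simp
  qed
  have Bl: "B * (a + d - (a + \<tau>)) \<le> \<mu> / 2"
  proof -
    have "B * (a + d - (a + \<tau>)) \<le> B * d" using B \<tau> by (intro mult_left_mono) auto
    then show ?thesis using B by simp
  qed
  have late: "append_last y (y $ i - w) \<notin> diagonals" "norm (driven_velocity (append_last y (y $ i - w)) - v) \<le> B"
    if "t \<in> {a + \<tau>..a + d}" "norm (y - (y1 + (t - (a + \<tau>)) *\<^sub>R v)) \<le> \<mu> / 2" for t y
    using off[of "t - a" y] bd[of "t - a" y] near[OF that(2)] that(1) \<tau> by (auto simp: y0_def)
  obtain X2 where X2: "driven (a + \<tau>) (a + d) X2" "init_part (X2 (a + \<tau>)) = y1"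
    "\<And>t. X2 t $ None = X2 t $ Some i - w"
    "\<And>t. t \<in> {a + \<tau>..a + d} \<Longrightarrow> norm (init_part (X2 t) - (y1 + (t - (a + \<tau>)) *\<^sub>R v)) \<le> B * (t - (a + \<tau>))"
    using steer_at_prescribed_offset[of "a + \<tau>" "a + d" "\<lambda>_. w" B "\<mu> / 2" y1 v i thesis] \<tau>d B Bl late by auto
  have X12: "X1 (a + \<tau>) = X2 (a + \<tau>)"
  proof -
    have "X2 (a + \<tau>) $ None = X1 (a + \<tau>) $ None"
      using X2(3)[of "a + \<tau>"] X1(4) arg_cong[OF X2(2), of "\<lambda>y. y $ i"] by (simp add: y1_def)
    then show ?thesis using append_last_init_part[of "X1 (a + \<tau>)"] append_last_init_part[of "X2 (a + \<tau>)"]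
      by (simp add: X2(2) y1_def)
  qed
  define X where "X t = (if t \<le> a + \<tau> then X1 t else X2 t)" for t
  show ?thesis
  proof
    show "driven a (a + d) X"
      unfolding X_def using driven_concat[OF X1(1) X2(1) X12] \<tau> \<tau>d by simp
    show "X a = x0" using \<tau> X1(2) by (simp add: X_def)
    show "X (a + d) $ None = X (a + d) $ Some i - w" using \<tau>d X2(3) by (simp add: X_def)
    fix t assume t: "t \<in> {a..a + d}"
    show "norm (init_part (X t) - (init_part x0 + (t - a) *\<^sub>R v)) \<le> \<mu>"
    proof (cases "t \<le> a + \<tau>")
      case True
      then show ?thesis using early[of t] t \<mu> by (simp add: X_def y0_def)
    next
      case False
      then have t': "t \<in> {a + \<tau>..a + d}" using t by auto
      have "B * (t - (a + \<tau>)) \<le> B * (a + d - (a + \<tau>))" using t B by (intro mult_left_mono) auto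
      then have "norm (init_part (X2 t) - (y1 + (t - (a + \<tau>)) *\<^sub>R v)) \<le> \<mu> / 2"
        using X2(4)[OF t'] Bl by linarith
      from near[OF this] show ?thesis using False by (simp add: X_def y0_def)
    qed
  qed
qed

text \<open>
  At \<open>w\<close> parallel to the preimage of \<open>V\<close> under \<open>A\<^sub>i\<close> the force is parallel to \<open>V\<close>, and its size is
  governed by \<open>f\<^sub>i(s) s\<^bsup>1-p\<^esup>\<close> with \<open>s = norm w\<close>. This quantity is continuous, keeps its
  sign near \<open>0\<close> and is unbounded there because \<open>p\<^sub>i > 1\<close>, so the intermediate value theorem
  yields \<open>s\<close>.
\<close>
lemma large_velocities_attained:
  assumes \<rho>: "\<rho> > 0"
  obtains R where "R > 0" "\<And>V. norm V \<ge> R \<Longrightarrow> \<exists>w. w \<noteq> 0 \<and> norm w \<le> \<rho> \<and> K i w = V"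
proof -
  obtain L0 where L0: "L0-lipschitz_on {0..} (f i)" using f_lip by blast
  define L where "L = L0 + 1"
  have L: "L > 0" "L-lipschitz_on {0..} (f i)"
    using lipschitz_on_nonneg[OF L0] lipschitz_on_mono[OF L0 order_refl, of L] by (auto simp: L_def)
  define \<phi> where "\<phi> s = sgn (f i 0) * f i s" for s
  define f0 where "f0 = \<bar>f i 0\<bar>"
  have f0: "f0 > 0" "\<phi> 0 = f0" using f_0[of i] by (auto simp: f0_def \<phi>_def sgn_if)
  define \<rho>1 where "\<rho>1 = min \<rho> (f0 / (2 * L))"
  have \<rho>1: "\<rho>1 > 0" "\<rho>1 \<le> \<rho>" using \<rho> f0 L by (auto simp: \<rho>1_def)
  have \<phi>: "\<phi> s \<ge> f0 / 2" if "s \<in> {0..\<rho>1}" for s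
  proof -
    have "\<bar>\<phi> s - \<phi> 0\<bar> = \<bar>f i s - f i 0\<bar>"
      using f_0[of i] by (simp add: \<phi>_def abs_mult flip: right_diff_distrib)
    also have "\<dots> \<le> L * s" using lipschitz_onD[OF L(2), of s 0] that by (simp add: dist_real_def)
    also have "\<dots> \<le> L * (f0 / (2 * L))" using that L by (intro mult_left_mono) (auto simp: \<rho>1_def)
    also have "\<dots> = f0 / 2" using L by simp
    finally show ?thesis using f0 by linarith
  qed
  have f_cont: "continuous_on {0..} (f i)" by (rule lipschitz_on_continuous_on[OF L(2)])
  define g where "g s = \<phi> s * s powr (1 - p i)" for s
  have g_cont: "continuous_on {s..\<rho>1} g" if "s > 0" for s
    unfolding g_def \<phi>_def
    by (intro continuous_intros continuous_on_subset[OF f_cont]) (use that in auto)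
  obtain C where C: "C > 0" "\<And>x. norm (A i *v x) \<le> norm x * C"
    using bounded_linear.pos_bounded[OF matrix_vector_mul_bounded_linear[of "A i"]] by blast
  obtain A' where A': "A i ** A' = mat 1" using A_inv[of i] unfolding invertible_def by blast
  have g1: "g \<rho>1 > 0" using \<phi>[of \<rho>1] \<rho>1 f0 by (auto simp: g_def intro!: mult_pos_pos)
  show ?thesis
  proof (rule that[of "C * g \<rho>1"])
    show "C * g \<rho>1 > 0" using C g1 by simp
    fix V :: "real ^ 'd" assume V: "norm V \<ge> C * g \<rho>1"
    define e where "e = A' *v V"
    have Ae: "A i *v e = V" by (simp add: e_def matrix_vector_mul_assoc A')
    have "C * g \<rho>1 \<le> C * norm e" using V C(2)[of e] by (simp add: Ae mult.commute)
    then have e1: "g \<rho>1 \<le> norm e" using C by simp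
    then have e0: "norm e > 0" using g1 by linarith
    \<comment> \<open>Here the lower bound \<open>f0 / 2 * s1 powr (1 - p i)\<close> for \<open>g s1\<close> reaches \<open>norm e\<close>.\<close>
  define s1 where "s1 = min \<rho>1 ((2 * norm e / f0) powr (1 / (1 - p i)))"
    have s1: "s1 > 0" "s1 \<le> \<rho>1" using \<rho>1 e0 f0 by (auto simp: s1_def)
    have "((2 * norm e / f0) powr (1 / (1 - p i))) powr (1 - p i) \<le> s1 powr (1 - p i)"
      using p_gt_1[of i] s1 by (intro powr_mono2') (auto simp: s1_def)
    then have "2 * norm e / f0 \<le> s1 powr (1 - p i)"
      using p_gt_1[of i] e0 f0 by (simp add: powr_powr)
    then have "norm e \<le> f0 / 2 * s1 powr (1 - p i)" using f0 by (simp add: field_simps)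
    also have "\<dots> \<le> g s1" unfolding g_def using \<phi>[of s1] s1 by (intro mult_right_mono) auto
    finally obtain s where s: "s1 \<le> s" "s \<le> \<rho>1" "g s = norm e"
      using IVT2'[of g \<rho>1 "norm e" s1] e1 s1 g_cont[OF s1(1)] by blast
    have s0: "s > 0" using s s1 by linarith
    define w where "w = (sgn (f i 0) * s / norm e) *\<^sub>R e"
    have nw: "norm w = s" using e0 s0 f_0[of i] by (simp add: w_def abs_mult)
    have "K i w = (f i s * (sgn (f i 0) * s / norm e) / s powr p i) *\<^sub>R V"
      using nw s0 by (subst K_eq) (auto simp: w_def matrix_vector_mult_scaleR Ae divide_inverse mult_ac)
    also have "f i s * (sgn (f i 0) * s / norm e) / s powr p i = g s / norm e"
      using s0 by (simp add: g_def \<phi>_def powr_diff mult_ac)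
    also have "\<dots> = 1" using s e0 by simp
    finally have "K i w = V" by simp
    moreover have "w \<noteq> 0" "norm w \<le> \<rho>" using nw s0 s \<rho>1 by auto
    ultimately show "\<exists>w. w \<noteq> 0 \<and> norm w \<le> \<rho> \<and> K i w = V" by blast
  qed
qed

end

section \<open>Tracking a curve by pushing the particles in turn\<close>

context driven_particles
begin

text \<open>
  The driven particles of a configuration in \<open>Y\<close> are uniformly separated. When the controlled
  particle is close to particle \<open>i\<close> it is therefore far from the others, and after removal of the
  singular term \<open>K\<^sub>i(w)\<close> the velocities extend continuously to \<open>w = 0\<close>, hence are bounded on a
  compact set.
\<close>
lemma close_interaction_bounds:
  assumes Y: "compact Y" "Y \<subseteq> - diagonals"
  obtains \<rho> B where "\<rho> > 0" "B > 0"
    "\<And>y i w. y \<in> Y \<Longrightarrow> w \<noteq> 0 \<Longrightarrow> norm w \<le> \<rho> \<Longrightarrow> append_last y (y $ i - w) \<notin> diagonals"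
    "\<And>y i w. y \<in> Y \<Longrightarrow> w \<noteq> 0 \<Longrightarrow> norm w \<le> \<rho> \<Longrightarrow>
       norm (driven_velocity (append_last y (y $ i - w)) - axis i (K i w)) \<le> B"
proof -
  have "\<exists>e>0. \<forall>y\<in>Y. \<forall>i j. i \<noteq> j \<longrightarrow> e < norm (y $ i - y $ j)"
  proof (cases "Y = {}")
    case True
    then show ?thesis by (intro exI[of _ 1]) auto
  next
    case False
    obtain e where e: "e > 0" "{y. infdist y Y \<le> e} \<subseteq> - diagonals"
      using compact_in_open_separated[OF False Y(1)] closed_diagonals Y(2) by (metis open_Compl)
    have "e < norm (y $ i - y $ j)" if "y \<in> Y" "i \<noteq> j" for y i j
    proof (rule ccontr)
      assume "\<not> e < norm (y $ i - y $ j)"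
      then have le: "norm (y $ j - y $ i) \<le> e" by (simp add: norm_minus_commute)
      define y' where "y' = y + axis i (y $ j - y $ i)"
      have "infdist y' Y \<le> dist y' y" by (rule infdist_le[OF that(1)])
      also have "\<dots> \<le> e" using le by (simp add: y'_def dist_norm)
      finally have "y' \<notin> diagonals" using e(2) by auto
      moreover have "y' $ i = y' $ j" using that(2) by (simp add: y'_def axis_def)
      ultimately show False using that(2) unfolding diagonals_def by blast
    qed
    with e(1) show ?thesis by blast
  qed
  then obtain e where e: "e > 0" "\<And>y i j. y \<in> Y \<Longrightarrow> i \<noteq> j \<Longrightarrow> e < norm (y $ i - y $ j)" by auto
  define \<rho> where "\<rho> = e / 2"
  have \<rho>: "\<rho> > 0" using e by (simp add: \<rho>_def)
  have sep: "y $ j - y $ i + w \<noteq> 0" if "y \<in> Y" "norm w \<le> \<rho>" "j \<noteq> i" for y i j w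
  proof
    assume "y $ j - y $ i + w = 0"
    then have "y $ j - y $ i = - w" by (simp add: eq_neg_iff_add_eq_0)
    then have "norm (y $ j - y $ i) = norm w" by simp
    then show False using e(2)[OF that(1,3)] that(2) \<rho> by (simp add: \<rho>_def)
  qed
  have off: "append_last y (y $ i - w) \<notin> diagonals" if "y \<in> Y" "w \<noteq> 0" "norm w \<le> \<rho>" for y i w
    unfolding append_last_off_diagonals
  proof (intro conjI allI)
    show "y \<notin> diagonals" using that Y by auto
    show "y $ j \<noteq> y $ i - w" for j
      using sep[OF that(1,3), of j i] that(2) by (cases "j = i") (auto simp: algebra_simps)
  qed
  define \<Phi> where "\<Phi> i = (\<lambda>(y, w). \<chi> j. (if j = i then 0 else K j (y $ j - y $ i + w))
      + (F_tilde j y + F_hat j (append_last y (y $ i - w))))" for i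
  have \<Phi>_eq: "driven_velocity (append_last y (y $ i - w)) - axis i (K i w) = \<Phi> i (y, w)"
    if "y \<in> Y" "w \<noteq> 0" "norm w \<le> \<rho>" for y i w
    using off[OF that, of i]
    by (auto simp: \<Phi>_def driven_velocity_def vec_eq_iff axis_def F_split algebra_simps)
  have "\<exists>B>0. \<forall>z\<in>Y \<times> cball 0 \<rho>. norm (\<Phi> i z) \<le> B" for i
  proof -
    have c: "compact (Y \<times> cball (0 :: real ^ 'd) \<rho>)" by (intro compact_Times Y) simp
    have "continuous_on (Y \<times> cball 0 \<rho>) (\<Phi> i)"
      unfolding \<Phi>_def split_beta
    proof (intro continuous_on_vec_lambda continuous_on_add)
      fix j
      show "continuous_on (Y \<times> cball 0 \<rho>) (\<lambda>z. if j = i then 0 else K j (fst z $ j - fst z $ i + snd z))"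
        using sep by (cases "j = i") (auto intro!: continuous_intros continuous_on_compose2[OF K_cont])
      obtain L where L: "L-lipschitz_on Y (F_tilde j)" using compactly_lipschitz_onD[OF F_tilde_lip Y] .
      show "continuous_on (Y \<times> cball 0 \<rho>) (\<lambda>z. F_tilde j (fst z))"
        by (rule continuous_on_compose2[OF lipschitz_on_continuous_on[OF L]]) (auto intro: continuous_intros)
      have ac: "continuous_on (Y \<times> cball 0 \<rho>) (\<lambda>z. append_last (fst z) (fst z $ i - snd z))"
        by (intro continuous_intros)
      obtain M where M: "M-lipschitz_on ((\<lambda>z. append_last (fst z) (fst z $ i - snd z)) ` (Y \<times> cball 0 \<rho>)) (F_hat j)"
        using compactly_lipschitz_onD[OF F_hat_lip compact_continuous_image[OF ac c]] by auto
      show "continuous_on (Y \<times> cball 0 \<rho>) (\<lambda>z. F_hat j (append_last (fst z) (fst z $ i - snd z)))"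
        by (rule continuous_on_compose2[OF lipschitz_on_continuous_on[OF M] ac]) auto
    qed
    from compact_imp_bounded[OF compact_continuous_image[OF this c]]
    show ?thesis unfolding bounded_pos by auto
  qed
  then obtain B where B: "\<And>i. B i > 0" "\<And>i z. z \<in> Y \<times> cball 0 \<rho> \<Longrightarrow> norm (\<Phi> i z) \<le> B i" by metis
  show ?thesis
  proof (rule that[OF \<rho> _ off])
    show "(\<Sum>i\<in>UNIV. B i) > 0" using B(1) by (intro sum_pos) auto
    fix y i and w :: "real ^ 'd" assume *: "y \<in> Y" "w \<noteq> 0" "norm w \<le> \<rho>"
    have "norm (\<Phi> i (y, w)) \<le> B i" using * by (intro B) auto
    also have "\<dots> \<le> (\<Sum>i\<in>UNIV. B i)" using B(1) by (intro member_le_sum) (auto simp: less_imp_le)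
    finally show "norm (driven_velocity (append_last y (y $ i - w)) - axis i (K i w)) \<le> (\<Sum>i\<in>UNIV. B i)"
      by (simp add: \<Phi>_eq[OF *])
  qed auto
qed

end

text \<open>
  A hierarchy of scales: positions are controlled up to multiples of \<open>\<eta>\<close>, each slot of duration
  \<open>d\<close> moves the particles that are not being pushed by at most \<open>\<mu>\<close>, and a full round of slots moves
  them by at most \<open>\<eta>\<close>. A displacement of length at least \<open>\<eta>\<close> within one slot takes a velocity of
  size at least \<open>\<eta> / d\<close>; this is at least \<open>R\<close>, so the singular force can supply it at an offset of at
  most \<open>\<rho>\<close>.
\<close>
locale pushing_regime = driven_particles K F F_tilde F_hat f A p
  for K :: "'n::finite \<Rightarrow> real ^ 'd \<Rightarrow> real ^ 'd" and F F_tilde F_hat f A p +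
  fixes Y :: "((real ^ 'd) ^ 'n) set" and \<rho> B R \<eta> \<mu> d :: real
  assumes off_Y: "\<And>y i w. y \<in> Y \<Longrightarrow> w \<noteq> 0 \<Longrightarrow> norm w \<le> \<rho> \<Longrightarrow> append_last y (y $ i - w) \<notin> diagonals"
    and bound_Y: "\<And>y i w. y \<in> Y \<Longrightarrow> w \<noteq> 0 \<Longrightarrow> norm w \<le> \<rho> \<Longrightarrow>
       norm (driven_velocity (append_last y (y $ i - w)) - axis i (K i w)) \<le> B"
    and push: "\<And>i V. norm V \<ge> R \<Longrightarrow> \<exists>w. w \<noteq> 0 \<and> norm w \<le> \<rho> \<and> K i w = V"
    and pos: "B > 0" "\<eta> > 0" "\<mu> > 0" "d > 0"
    and small: "CARD('n) * \<mu> \<le> \<eta>" "B * d \<le> \<mu> / 2" "R * d \<le> \<eta>"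
begin

lemma mu_le_eta: "\<mu> \<le> \<eta>"
proof -
  have "1 * \<mu> \<le> CARD('n) * \<mu>" using pos by (intro mult_right_mono) (auto simp: Suc_le_eq)
  then show ?thesis using small by simp
qed

text \<open>
  The aim \<open>p\<close> is a point within \<open>2 \<eta>\<close> of \<open>q\<^sub>i\<close> but at least \<open>\<eta>\<close> away from particle \<open>i\<close>: the
  center \<open>q\<^sub>i\<close> itself, or a point at distance \<open>2 \<eta>\<close> from it when the particle is close to the center.
  This makes the velocity large enough to be produced by the singular force. The particle then
  moves along a segment, on which the distance to \<open>q\<^sub>i\<close> is controlled by that of the end points.
\<close>
lemma push_one_particle:
  assumes x0: "x0 \<notin> diagonals" "\<And>j. norm (x0 $ Some j - q $ j) \<le> 5 * \<eta>"
    and inY: "\<And>y. (\<And>j. norm (y $ j - q $ j) \<le> 6 * \<eta>) \<Longrightarrow> y \<in> Y"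
  obtains X where "driven a (a + d) X" "X a = x0"
    "\<And>t j. t \<in> {a..a + d} \<Longrightarrow> j \<noteq> i \<Longrightarrow> norm (X t $ Some j - x0 $ Some j) \<le> \<mu>"
    "\<And>t. t \<in> {a..a + d} \<Longrightarrow> norm (X t $ Some i - q $ i) \<le> max (2 * \<eta>) (norm (x0 $ Some i - q $ i)) + \<mu>"
    "norm (X (a + d) $ Some i - q $ i) \<le> 2 * \<eta> + \<mu>"
proof -
  define y0 where "y0 = x0 $ Some i"
  obtain p where p: "norm (p - q $ i) \<le> 2 * \<eta>" "\<eta> \<le> norm (p - y0)"
  proof (cases "\<eta> \<le> norm (q $ i - y0)")
    case True
    then show ?thesis using pos that[of "q $ i"] by simp
  next
    case False
    obtain h :: "real ^ 'd" where h: "norm h = 2 * \<eta>" using vector_choose_size[of "2 * \<eta>"] pos by auto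
    have "norm h \<le> norm (q $ i + h - y0) + norm (q $ i - y0)"
      using norm_triangle_ineq4[of "q $ i + h - y0" "q $ i - y0"] by simp
    then show ?thesis using False h by (intro that[of "q $ i + h"]) auto
  qed
  define V where "V = (1 / d) *\<^sub>R (p - y0)"
  have "R \<le> \<eta> / d" using small(3) pos by (simp add: pos_le_divide_eq)
  also have "\<dots> \<le> norm V" using p(2) pos by (simp add: V_def divide_right_mono)
  finally obtain w where w: "w \<noteq> 0" "norm w \<le> \<rho>" "K i w = V" using push by blast
  have line: "y0 + t *\<^sub>R V - q $ i = (1 - t / d) *\<^sub>R (y0 - q $ i) + (t / d) *\<^sub>R (p - q $ i)" for t
    by (simp add: V_def algebra_simps)
  have seg: "norm (y0 + t *\<^sub>R V - q $ i) \<le> max (2 * \<eta>) (norm (y0 - q $ i))" if t: "t \<in> {0..d}" for t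
  proof -
    define m where "m = max (2 * \<eta>) (norm (y0 - q $ i))"
    have "norm (y0 + t *\<^sub>R V - q $ i) \<le> (1 - t / d) * norm (y0 - q $ i) + (t / d) * norm (p - q $ i)"
      unfolding line using t pos by (intro norm_triangle_le) (auto simp: divide_simps)
    also have "\<dots> \<le> (1 - t / d) * m + (t / d) * m"
      using t pos p(1) by (intro add_mono mult_left_mono) (auto simp: m_def divide_simps)
    also have "\<dots> = m" by (simp add: algebra_simps)
    finally show ?thesis by (simp add: m_def)
  qed
  have ref: "(init_part x0 + t *\<^sub>R axis i V) $ j = (if j = i then y0 + t *\<^sub>R V else x0 $ Some j)" for t j
    by (simp add: axis_def y0_def)
  have comp: "norm (y $ j - (if j = i then y0 + t *\<^sub>R V else x0 $ Some j)) \<le> \<mu>"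
    if "norm (y - (init_part x0 + t *\<^sub>R axis i V)) \<le> \<mu>" for y t j
    using order_trans[OF Finite_Cartesian_Product.norm_nth_le that, of j]
    by (simp add: ref del: vector_add_component)
  have tubeY: "y \<in> Y"
    if t: "t \<in> {0..d}" and y: "norm (y - (init_part x0 + t *\<^sub>R axis i V)) \<le> \<mu>" for t y
  proof (rule inY)
    fix j
    have "norm ((if j = i then y0 + t *\<^sub>R V else x0 $ Some j) - q $ j) \<le> 5 * \<eta>"
      using seg[OF t] x0(2)[of j] pos by (auto simp: y0_def)
    from norm_triangle_mono[OF comp[OF y, of j] this] show "norm (y $ j - q $ j) \<le> 6 * \<eta>"
      using mu_le_eta by simp
  qed
  obtain X where X: "driven a (a + d) X" "X a = x0"
    "\<And>t. t \<in> {a..a + d} \<Longrightarrow> norm (init_part (X t) - (init_part x0 + (t - a) *\<^sub>R axis i V)) \<le> \<mu>"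
    using relocate_then_drive[OF x0(1), of d \<mu> B "axis i V" i w a thesis] pos small(2)
      off_Y[OF tubeY w(1,2)] bound_Y[OF tubeY w(1,2), of _ _ i] w(3) by auto
  have Xc: "norm (X t $ Some j - (if j = i then y0 + (t - a) *\<^sub>R V else x0 $ Some j)) \<le> \<mu>"
    if "t \<in> {a..a + d}" for t j
    using comp[OF X(3)[OF that], of j] by simp
  show ?thesis
  proof (rule that[OF X(1,2)])
    show "norm (X t $ Some j - x0 $ Some j) \<le> \<mu>" if "t \<in> {a..a + d}" "j \<noteq> i" for t j
      using Xc[OF that(1), of j] that(2) by simp
    show "norm (X t $ Some i - q $ i) \<le> max (2 * \<eta>) (norm (x0 $ Some i - q $ i)) + \<mu>"
      if "t \<in> {a..a + d}" for t
    proof -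
      have "norm (X t $ Some i - (y0 + (t - a) *\<^sub>R V)) \<le> \<mu>" using Xc[OF that, of i] by simp
      moreover have "t - a \<in> {0..d}" using that by auto
      ultimately show ?thesis
        using norm_triangle_mono[OF _ seg[of "t - a"]] by (fastforce simp: y0_def)
    qed
    have "norm (X (a + d) $ Some i - p) \<le> \<mu>" using Xc[of "a + d" i] pos by (simp add: V_def)
    from norm_triangle_mono[OF this p(1)] show "norm (X (a + d) $ Some i - q $ i) \<le> 2 * \<eta> + \<mu>" by simp
  qed
qed

text \<open>
  One round of slots, by induction over the set of particles that have had theirs. Errors
  of \<open>\<mu>\<close> per slot add up to at most \<open>\<eta>\<close>: the bound \<open>4 \<eta>\<close> on the particles that wait becomes \<open>5 \<eta>\<close>,
  the bound \<open>2 \<eta>\<close> on those just pushed becomes \<open>3 \<eta>\<close>.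
\<close>
lemma push_all_particles:
  assumes x0: "x0 \<notin> diagonals" "\<And>j. norm (x0 $ Some j - q $ j) \<le> 4 * \<eta>"
    and inY: "\<And>y. (\<And>j. norm (y $ j - q $ j) \<le> 6 * \<eta>) \<Longrightarrow> y \<in> Y"
  obtains X where "driven a (a + CARD('n) * d) X" "X a = x0"
    "\<And>t j. t \<in> {a..a + CARD('n) * d} \<Longrightarrow> norm (X t $ Some j - q $ j) \<le> 5 * \<eta>"
    "\<And>j. norm (X (a + CARD('n) * d) $ Some j - q $ j) \<le> 3 * \<eta>"
proof -
  have "\<exists>X. driven a (a + card J * d) X \<and> X a = x0 \<and>
      (\<forall>t\<in>{a..a + card J * d}. \<forall>j. norm (X t $ Some j - q $ j) \<le> 4 * \<eta> + card J * \<mu>) \<and>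
      (\<forall>j\<in>J. norm (X (a + card J * d) $ Some j - q $ j) \<le> 2 * \<eta> + card J * \<mu>)"
    for J :: "'n set"
  proof (induction J rule: finite_induct[OF finite])
    case 1
    have "driven a a (\<lambda>_. x0)" using x0(1) by (simp add: driven_def)
    then show ?case using x0(2) by (intro exI[of _ "\<lambda>_. x0"]) simp
  next
    case (2 i J)
    then obtain X where X: "driven a (a + card J * d) X" "X a = x0"
      "\<And>t j. t \<in> {a..a + card J * d} \<Longrightarrow> norm (X t $ Some j - q $ j) \<le> 4 * \<eta> + card J * \<mu>"
      "\<And>j. j \<in> J \<Longrightarrow> norm (X (a + card J * d) $ Some j - q $ j) \<le> 2 * \<eta> + card J * \<mu>" by blast
    define b where "b = a + card J * d"
    have ab: "a \<le> b" using pos by (simp add: b_def)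
    have card: "card (insert i J) = Suc (card J)" using 2 by simp
    have b': "a + card (insert i J) * d = b + d" unfolding card b_def by (simp add: algebra_simps)
    have "card J \<le> CARD('n)" by (rule card_mono) auto
    then have "card J * \<mu> \<le> CARD('n) * \<mu>" using pos by (intro mult_right_mono) auto
    then have le: "card J * \<mu> \<le> \<eta>" using small(1) by simp
    have Xb: "X b \<notin> diagonals" "\<And>j. norm (X b $ Some j - q $ j) \<le> 4 * \<eta> + card J * \<mu>"
      using drivenD(2)[OF X(1)] X(3)[of b] ab by (auto simp: b_def)
    have Xb5: "norm (X b $ Some j - q $ j) \<le> 5 * \<eta>" for j
      using Xb(2)[of j] le by linarith
    obtain Z where Z: "driven b (b + d) Z" "Z b = X b"
      "\<And>t j. t \<in> {b..b + d} \<Longrightarrow> j \<noteq> i \<Longrightarrow> norm (Z t $ Some j - X b $ Some j) \<le> \<mu>"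
      "\<And>t. t \<in> {b..b + d} \<Longrightarrow> norm (Z t $ Some i - q $ i) \<le> max (2 * \<eta>) (norm (X b $ Some i - q $ i)) + \<mu>"
      "norm (Z (b + d) $ Some i - q $ i) \<le> 2 * \<eta> + \<mu>"
      using push_one_particle[OF Xb(1) Xb5 inY, of b i thesis] by blast
    define W where "W t = (if t \<le> b then X t else Z t)" for t
    have W1: "driven a (b + d) W"
      unfolding W_def using driven_concat[OF X(1)[folded b_def] Z(1)] Z(2) ab pos by simp
    have W2: "W a = x0" using ab X(2) by (simp add: W_def)
    have W3: "norm (W t $ Some j - q $ j) \<le> 4 * \<eta> + Suc (card J) * \<mu>" if t: "t \<in> {a..b + d}" for t j
    proof (cases "t \<le> b")
      case True
      then show ?thesis using X(3)[of t j] t pos by (simp add: W_def b_def algebra_simps)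
    next
      case False
      then have t': "t \<in> {b..b + d}" using t by auto
      show ?thesis
      proof (cases "j = i")
        case True
        have "max (2 * \<eta>) (norm (X b $ Some i - q $ i)) \<le> 4 * \<eta> + card J * \<mu>" using Xb(2)[of i] pos by simp
        with Z(4)[OF t'] have "norm (Z t $ Some i - q $ i) \<le> 4 * \<eta> + card J * \<mu> + \<mu>" by linarith
        then show ?thesis using False True by (simp add: W_def algebra_simps)
      next
        case ji: False
        from norm_triangle_mono[OF Z(3)[OF t' ji] Xb(2)[of j]] show ?thesis
          using False by (simp add: W_def algebra_simps)
      qed
    qed
    have W4: "norm (W (b + d) $ Some j - q $ j) \<le> 2 * \<eta> + Suc (card J) * \<mu>" if "j \<in> insert i J" for j
    proof (cases "j = i")
      case True
      have "2 * \<eta> + \<mu> \<le> 2 * \<eta> + Suc (card J) * \<mu>" using pos by (simp add: distrib_right)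
      with Z(5) have "norm (Z (b + d) $ Some i - q $ i) \<le> 2 * \<eta> + Suc (card J) * \<mu>" by (rule order_trans)
      then show ?thesis using True pos by (simp add: W_def)
    next
      case False
      then have "norm (X b $ Some j - q $ j) \<le> 2 * \<eta> + card J * \<mu>" using that X(4) by (simp add: b_def)
      from norm_triangle_mono[OF Z(3)[of "b + d" j] this] show ?thesis
        using False pos by (simp add: W_def algebra_simps)
    qed
    show ?case unfolding b' unfolding card by (intro exI[of _ W] conjI ballI allI W1 W2 W3 W4)
  qed
  from this[of UNIV] obtain X where X: "driven a (a + CARD('n) * d) X" "X a = x0"
    "\<And>t j. t \<in> {a..a + CARD('n) * d} \<Longrightarrow> norm (X t $ Some j - q $ j) \<le> 4 * \<eta> + CARD('n) * \<mu>"
    "\<And>j. norm (X (a + CARD('n) * d) $ Some j - q $ j) \<le> 2 * \<eta> + CARD('n) * \<mu>" by blast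
  show ?thesis
  proof (rule that[OF X(1,2)])
    show "norm (X t $ Some j - q $ j) \<le> 5 * \<eta>" if "t \<in> {a..a + CARD('n) * d}" for t j
      using X(3)[OF that, of j] small(1) by simp
    show "norm (X (a + CARD('n) * d) $ Some j - q $ j) \<le> 3 * \<eta>" for j
      using X(4)[of j] small(1) by simp
  qed
qed

text \<open>
  In each round the target curve is frozen at its value at the beginning. It moves by at most \<open>\<eta>\<close>
  during the round, which turns the final \<open>3 \<eta>\<close> back into the initial \<open>4 \<eta>\<close> and the intermediate
  \<open>5 \<eta>\<close> into \<open>6 \<eta>\<close>.
\<close>
lemma shadow_periods:
  assumes x0: "x0 \<notin> diagonals" "init_part x0 = c 0"
    and inY: "\<And>y t. t \<in> {0..T} \<Longrightarrow> (\<And>j. norm (y $ j - c t $ j) \<le> 6 * \<eta>) \<Longrightarrow> y \<in> Y"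
    and modulus: "\<And>s t j. s \<in> {0..T} \<Longrightarrow> t \<in> {0..T} \<Longrightarrow> \<bar>s - t\<bar> \<le> CARD('n) * d \<Longrightarrow> norm (c s $ j - c t $ j) \<le> \<eta>"
    and m: "real m * (CARD('n) * d) \<le> T"
  shows "\<exists>X. driven 0 (m * (CARD('n) * d)) X \<and> X 0 = x0 \<and>
    (\<forall>t\<in>{0..m * (CARD('n) * d)}. \<forall>j. norm (X t $ Some j - c t $ j) \<le> 6 * \<eta>) \<and>
    (\<forall>j. norm (X (m * (CARD('n) * d)) $ Some j - c (m * (CARD('n) * d)) $ j) \<le> 4 * \<eta>)"
  using m
proof (induction m)
  case 0
  have "driven 0 0 (\<lambda>_. x0)" using x0(1) by (simp add: driven_def)
  moreover have "x0 $ Some j = c 0 $ j" for j using x0(2) by (metis init_part_nth)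
  ultimately show ?case using pos by (intro exI[of _ "\<lambda>_. x0"]) simp
next
  case (Suc m)
  define P where "P = CARD('n) * d"
  have P: "P > 0" using pos by (simp add: P_def)
  define b where "b = m * P"
  have SP: "Suc m * P = b + P" by (simp add: b_def algebra_simps)
  moreover have "Suc m * P \<le> T" using Suc.prems unfolding P_def .
  ultimately have b: "0 \<le> b" "b + P \<le> T" using P by (auto simp: b_def)
  obtain X where X: "driven 0 b X" "X 0 = x0" "\<And>t j. t \<in> {0..b} \<Longrightarrow> norm (X t $ Some j - c t $ j) \<le> 6 * \<eta>"
    "\<And>j. norm (X b $ Some j - c b $ j) \<le> 4 * \<eta>"
    using Suc.IH b P unfolding P_def[symmetric] b_def[symmetric] by auto
  have "X b \<notin> diagonals" using drivenD(2)[OF X(1)] b by simp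
  then obtain Z where Z: "driven b (b + P) Z" "Z b = X b"
    "\<And>t j. t \<in> {b..b + P} \<Longrightarrow> norm (Z t $ Some j - c b $ j) \<le> 5 * \<eta>"
    "\<And>j. norm (Z (b + P) $ Some j - c b $ j) \<le> 3 * \<eta>"
    using push_all_particles[of "X b" "c b" b thesis] X(4) inY[of b] b P unfolding P_def[symmetric] by auto
  define W where "W t = (if t \<le> b then X t else Z t)" for t
  have "driven 0 (b + P) W"
    unfolding W_def using driven_concat[OF X(1) Z(1)] Z(2) b P by simp
  moreover have "W 0 = x0" using b X(2) by (simp add: W_def)
  moreover have "norm (W t $ Some j - c t $ j) \<le> 6 * \<eta>" if t: "t \<in> {0..b + P}" for t j
  proof (cases "t \<le> b")
    case False
    have "norm (c b $ j - c t $ j) \<le> \<eta>" using False t b by (intro modulus) (auto simp: P_def[symmetric])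
    from norm_triangle_mono[OF Z(3)[of t j] this] show ?thesis using False t by (simp add: W_def)
  qed (use X(3) t in \<open>simp add: W_def\<close>)
  moreover have "norm (W (b + P) $ Some j - c (b + P) $ j) \<le> 4 * \<eta>" for j
  proof -
    have "norm (c b $ j - c (b + P) $ j) \<le> \<eta>" using b P by (intro modulus) (auto simp: P_def[symmetric])
    from norm_triangle_mono[OF Z(4)[of j] this] show ?thesis using P by (simp add: W_def)
  qed
  ultimately show ?case unfolding P_def[symmetric] SP by blast
qed

end

context driven_particles
begin

text \<open>
  After \<open>M\<close> rounds one further slot remains, in which the controlled particle is taken to
  its final position and kept near it. That position is off the final configuration of the driven
  particles, so the forces are bounded there and the slot changes little.
\<close>
lemma shadow_curve:
  assumes T: "T > 0" and c: "continuous_on {0..T} c" "\<And>t. t \<in> {0..T} \<Longrightarrow> c t \<notin> diagonals"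
    and x_in: "x_in \<notin> diagonals" "init_part x_in = c 0"
    and x_fin: "x_fin \<notin> diagonals" "init_part x_fin = c T"
    and \<epsilon>: "\<epsilon> > 0"
  obtains X where "driven 0 T X" "X 0 = x_in"
    "\<And>t j. t \<in> {0..T} \<Longrightarrow> norm (X t $ Some j - c t $ j) \<le> \<epsilon>"
    "norm (X T $ None - x_fin $ None) \<le> \<epsilon>"
proof -
  define N where "N = real CARD('n)"
  have N: "N \<ge> 1" by (simp add: N_def Suc_le_eq)
  define Q where "Q = c ` {0..T}"
  have Q: "compact Q" "Q \<noteq> {}" "Q \<subseteq> - diagonals"
    using T c by (auto simp: Q_def intro: compact_continuous_image)
  obtain r where r: "r > 0" "{y. infdist y Q \<le> r} \<subseteq> - diagonals"
    using compact_in_open_separated[OF Q(2,1) _ Q(3)] closed_diagonals by (metis open_Compl)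
  define Y where "Y = {y. infdist y Q \<le> r}"
  have Y: "compact Y" "Y \<subseteq> - diagonals"
    using compact_infdist_le[OF Q(2,1) r(1)] r(2) by (auto simp: Y_def)
  obtain \<rho> B1 where \<rho>: "\<rho> > 0" and B1: "B1 > 0"
    and off_Y: "\<And>y i w. y \<in> Y \<Longrightarrow> w \<noteq> 0 \<Longrightarrow> norm w \<le> \<rho> \<Longrightarrow> append_last y (y $ i - w) \<notin> diagonals"
    and bound_Y: "\<And>y i w. y \<in> Y \<Longrightarrow> w \<noteq> 0 \<Longrightarrow> norm w \<le> \<rho> \<Longrightarrow>
       norm (driven_velocity (append_last y (y $ i - w)) - axis i (K i w)) \<le> B1"
    using close_interaction_bounds[OF Y, of thesis] by blast
  obtain r' where r': "r' > 0" "cball x_fin r' \<subseteq> - diagonals"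
    using closed_diagonals x_fin(1) by (metis ComplI open_Compl open_contains_cball)
  have "bounded (driven_velocity ` cball x_fin r')"
    by (intro compact_imp_bounded compact_continuous_image continuous_on_subset[OF driven_velocity_continuous] r') simp
  then obtain B2 where B2: "B2 > 0" "\<And>x. x \<in> cball x_fin r' \<Longrightarrow> norm (driven_velocity x) \<le> B2"
    unfolding bounded_pos by auto
  define B where "B = max B1 B2"
  have B: "B > 0" "B1 \<le> B" "B2 \<le> B" using B1 by (auto simp: B_def)
  have "\<exists>R>0. \<forall>V. norm V \<ge> R \<longrightarrow> (\<exists>w. w \<noteq> 0 \<and> norm w \<le> \<rho> \<and> K i w = V)" for i
    using large_velocities_attained[OF \<rho>, of i] by metis
  then obtain R' where R': "\<And>i. R' i > 0"
    "\<And>i V. norm V \<ge> R' i \<Longrightarrow> \<exists>w. w \<noteq> 0 \<and> norm w \<le> \<rho> \<and> K i w = V" by metis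
  define R where "R = (\<Sum>i\<in>UNIV. R' i)"
  have R'_le: "R' i \<le> R" for i
    unfolding R_def using R'(1) by (intro member_le_sum) (auto simp: less_imp_le)
  have R: "R > 0" using R'_le[of undefined] R'(1)[of undefined] by linarith
  \<comment> \<open>Componentwise errors of \<open>6 \<eta>\<close> give up to \<open>6 N \<eta>\<close> for whole configurations; the factor
    \<open>7 (N + 1)\<close> leaves room for further terms of size \<open>\<eta>\<close>.\<close>
  define \<eta> where "\<eta> = min r (min r' \<epsilon>) / (7 * (N + 1))"
  have \<eta>: "\<eta> > 0" using r r' \<epsilon> N by (simp add: \<eta>_def)
  have "7 * (N + 1) * \<eta> = min r (min r' \<epsilon>)" using N by (simp add: \<eta>_def)
  then have \<eta>le: "7 * (N * \<eta>) + 7 * \<eta> \<le> r" "7 * (N * \<eta>) + 7 * \<eta> \<le> r'" "7 * (N * \<eta>) + 7 * \<eta> \<le> \<epsilon>"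
    by (simp_all add: algebra_simps)
  have N\<eta>: "N * \<eta> > 0" using N \<eta> by simp
  define \<mu> where "\<mu> = \<eta> / N"
  have \<mu>: "\<mu> > 0" "N * \<mu> = \<eta>" using \<eta> N by (auto simp: \<mu>_def)
  have "uniformly_continuous_on {0..T} c" by (rule compact_uniformly_continuous[OF c(1)]) simp
  then obtain \<delta> where \<delta>: "\<delta> > 0"
    "\<And>s t. s \<in> {0..T} \<Longrightarrow> t \<in> {0..T} \<Longrightarrow> dist s t < \<delta> \<Longrightarrow> dist (c s) (c t) < \<eta>"
    using \<eta> unfolding uniformly_continuous_on_def by metis
  define d0 where "d0 = min (\<mu> / (2 * B)) (min (\<eta> / R) (\<delta> / (2 * N)))"
  have d0: "d0 > 0" using \<mu> B \<eta> R \<delta> N by (simp add: d0_def)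
  obtain M :: nat where M: "T / d0 \<le> real M" using real_arch_simple by blast
  \<comment> \<open>\<open>M\<close> rounds of \<open>N\<close> slots and the final slot fill \<open>[0, T]\<close> exactly.\<close>
  define d where "d = T / (M * N + 1)"
  have MN: "M * N + 1 > 0" using N by (simp add: add_nonneg_pos)
  have d: "d > 0" using T MN by (simp add: d_def)
  have Md: "M * (N * d) = T - d"
  proof -
    have "(M * N + 1) * d = T" using MN by (simp add: d_def)
    then show ?thesis by (simp add: algebra_simps)
  qed
  have dd0: "d \<le> d0"
  proof -
    have "real M * 1 \<le> M * N" using N by (intro mult_left_mono) auto
    then have "T / d0 \<le> M * N + 1" using M by linarith
    then show ?thesis using d0 MN by (simp add: d_def field_simps)
  qed
  have Bd: "B * d \<le> \<mu> / 2"
    using mult_left_mono[OF order_trans[OF dd0, of "\<mu> / (2 * B)"], of B] B by (simp add: d0_def)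
  have Rd: "R * d \<le> \<eta>"
    using mult_left_mono[OF order_trans[OF dd0, of "\<eta> / R"], of R] R by (simp add: d0_def)
  have Nd: "N * d < \<delta>"
  proof -
    have "N * d \<le> N * (\<delta> / (2 * N))" using dd0 N by (intro mult_left_mono) (auto simp: d0_def)
    also have "\<dots> = \<delta> / 2" using N by simp
    finally show ?thesis using \<delta>(1) by simp
  qed
  have modulus: "norm (c s $ j - c t $ j) \<le> \<eta>"
    if "s \<in> {0..T}" "t \<in> {0..T}" "\<bar>s - t\<bar> \<le> N * d" for s t j
    using \<delta>(2)[OF that(1,2)] that(3) Nd Finite_Cartesian_Product.norm_nth_le[of "c s - c t" j]
    by (simp add: dist_norm)
  have inY: "y \<in> Y" if "t \<in> {0..T}" "\<And>j. norm (y $ j - c t $ j) \<le> 6 * \<eta>" for y t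
  proof -
    have "infdist y Q \<le> dist y (c t)" by (rule infdist_le) (use that in \<open>auto simp: Q_def\<close>)
    also have "\<dots> \<le> N * (6 * \<eta>)"
      unfolding dist_norm N_def by (rule norm_le_if_components_le) (use that in simp)
    finally show ?thesis using \<eta>le(1) N\<eta> \<eta> by (simp add: Y_def)
  qed
  interpret pushing_regime K F F_tilde F_hat f A p Y \<rho> B R \<eta> \<mu> d
  proof unfold_locales
    show "append_last y (y $ i - w) \<notin> diagonals" if "y \<in> Y" "w \<noteq> 0" "norm w \<le> \<rho>" for y i w
      using off_Y that .
    show "norm (driven_velocity (append_last y (y $ i - w)) - axis i (K i w)) \<le> B"
      if "y \<in> Y" "w \<noteq> 0" "norm w \<le> \<rho>" for y i w
      using bound_Y[OF that, of i] B by linarith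
    show "\<exists>w. w \<noteq> 0 \<and> norm w \<le> \<rho> \<and> K i w = V" if "R \<le> norm V" for i V
      by (rule R'(2)) (use R'_le[of i] that in linarith)
  qed (use B \<eta> \<mu> d Bd Rd in \<open>auto simp: N_def\<close>)
  define b where "b = T - d"
  have "0 \<le> M * (N * d)" using N d by simp
  then have b: "0 \<le> b" "b < T" "b + d = T"
    using d by (simp_all add: Md b_def)
  have Mb: "M * (CARD('n) * d) = b" using Md by (simp add: b_def N_def)
  then have MT: "M * (CARD('n) * d) \<le> T" using b by simp
  have "\<exists>X. driven 0 (M * (CARD('n) * d)) X \<and> X 0 = x_in \<and>
    (\<forall>t\<in>{0..M * (CARD('n) * d)}. \<forall>j. norm (X t $ Some j - c t $ j) \<le> 6 * \<eta>) \<and>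
    (\<forall>j. norm (X (M * (CARD('n) * d)) $ Some j - c (M * (CARD('n) * d)) $ j) \<le> 4 * \<eta>)"
  proof (rule shadow_periods[where T = T and c = c, OF x_in _ _ MT])
    show "y \<in> Y" if "t \<in> {0..T}" "\<And>j. norm (y $ j - c t $ j) \<le> 6 * \<eta>" for y t
      by (rule inY[OF that])
    show "norm (c s $ j - c t $ j) \<le> \<eta>"
      if "s \<in> {0..T}" "t \<in> {0..T}" "\<bar>s - t\<bar> \<le> CARD('n) * d" for s t j
      by (rule modulus[OF that(1,2)]) (use that(3) in \<open>simp add: N_def\<close>)
  qed
  then obtain X where X: "driven 0 b X" "X 0 = x_in"
    "\<And>t j. t \<in> {0..b} \<Longrightarrow> norm (X t $ Some j - c t $ j) \<le> 6 * \<eta>"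
    "\<And>j. norm (X b $ Some j - c b $ j) \<le> 4 * \<eta>"
    unfolding Mb by blast
  have Xb: "X b \<notin> diagonals" using drivenD(2)[OF X(1)] b by simp
  have d_le: "d \<le> N * d" using N d by simp
  have late: "norm (X b $ Some j - c t $ j) \<le> 5 * \<eta>" if "t \<in> {b..T}" for t j
  proof -
    have bt: "b \<le> t" "t - b \<le> d" using that b by auto
    then have "\<bar>b - t\<bar> \<le> N * d" using d_le by linarith
    then have "norm (c b $ j - c t $ j) \<le> \<eta>" using that b by (intro modulus) auto
    from norm_triangle_mono[OF X(4)[of j] this] show ?thesis by simp
  qed
  define i :: 'n where "i = undefined"
  \<comment> \<open>In the last slot the controlled particle is kept at a constant offset from an arbitrary
    particle, which is almost at rest.\<close>
  define w where "w = X b $ Some i - x_fin $ None"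
  have hold: "append_last y (y $ i - w) \<in> cball x_fin r'" if y: "norm (y - init_part (X b)) \<le> \<mu>" for y
  proof -
    have "append_last y (y $ i - w) - x_fin = append_last y (y $ i - w) - append_last (c T) (x_fin $ None)"
      by (simp flip: x_fin(2))
    also have "\<dots> = append_last (y - c T) ((y - init_part (X b)) $ i)"
      by (simp add: append_last_diff w_def algebra_simps)
    also have "norm \<dots> \<le> norm (y - c T) + norm ((y - init_part (X b)) $ i)" by (rule norm_append_last_le)
    also have "norm ((y - init_part (X b)) $ i) \<le> \<mu>"
      using y Finite_Cartesian_Product.norm_nth_le order_trans by blast
    also have "norm (y - c T) \<le> N * (6 * \<eta>)"
      unfolding N_def
    proof (rule norm_le_if_components_le)
      fix j
      have "norm ((y - init_part (X b)) $ j) \<le> \<mu>"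
        using y Finite_Cartesian_Product.norm_nth_le order_trans by blast
      then have "norm (y $ j - X b $ Some j) \<le> \<mu>" by simp
      from norm_triangle_mono[OF this late[of T j]] show "norm ((y - c T) $ j) \<le> 6 * \<eta>"
        using b mu_le_eta by simp
    qed
    finally have "norm (append_last y (y $ i - w) - x_fin) \<le> N * (6 * \<eta>) + \<mu>" by simp
    then show ?thesis using \<eta>le(2) mu_le_eta N\<eta> \<eta> by (simp add: dist_norm norm_minus_commute)
  qed
  obtain Z where Z: "driven b (b + d) Z" "Z b = X b"
    "\<And>t. t \<in> {b..b + d} \<Longrightarrow> norm (init_part (Z t) - (init_part (X b) + (t - b) *\<^sub>R 0)) \<le> \<mu>"
    "Z (b + d) $ None = Z (b + d) $ Some i - w"
  proof (rule relocate_then_drive[OF Xb d \<mu>(1) _ Bd, of 0 i w b])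
    fix t y assume "t \<in> {0..d}" "norm (y - (init_part (X b) + t *\<^sub>R 0)) \<le> \<mu>"
    then have *: "append_last y (y $ i - w) \<in> cball x_fin r'" by (intro hold) simp
    then show "append_last y (y $ i - w) \<notin> diagonals" using r' by auto
    from B2(2)[OF *] show "norm (driven_velocity (append_last y (y $ i - w)) - 0) \<le> B" using B by simp
  qed (use B in auto)
  have Zj: "norm (Z t $ Some j - X b $ Some j) \<le> \<mu>" if "t \<in> {b..T}" for t j
    using Z(3)[of t] that b Finite_Cartesian_Product.norm_nth_le[of "init_part (Z t) - init_part (X b)" j]
    by simp
  define W where "W t = (if t \<le> b then X t else Z t)" for t
  show ?thesis
  proof
    show "driven 0 T W"
      unfolding W_def using driven_concat[OF X(1) Z(1)] Z(2) b by simp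
    show "W 0 = x_in" using b X(2) by (simp add: W_def)
    have six: "6 * \<eta> \<le> \<epsilon>" using \<eta>le(3) N\<eta> \<eta> by linarith
    show "norm (W t $ Some j - c t $ j) \<le> \<epsilon>" if t: "t \<in> {0..T}" for t j
    proof (cases "t \<le> b")
      case True
      then show ?thesis using X(3)[of t j] t six by (simp add: W_def)
    next
      case False
      then have "t \<in> {b..T}" using t by auto
      from norm_triangle_mono[OF Zj[OF this, of j] late[OF this, of j]] show ?thesis
        using False six mu_le_eta by (simp add: W_def)
    qed
    have "W T $ None - x_fin $ None = Z T $ Some i - X b $ Some i"
      using Z(4) b by (simp add: W_def w_def)
    then show "norm (W T $ None - x_fin $ None) \<le> \<epsilon>"
      using Zj[of T i] b six mu_le_eta \<eta> by simp
  qed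
qed

end

section \<open>Passing from a path of the controlled particle to a smooth control\<close>

context driven_particles
begin

definition uncontrolled_field :: "(real ^ 'd) ^ 'n option \<Rightarrow> (real ^ 'd) ^ 'n option" where
  "uncontrolled_field x = append_last (driven_velocity x) (F None x)"

lemma uncontrolled_field_compactly_lipschitz: "compactly_lipschitz_on (- diagonals) uncontrolled_field"
proof (rule compactly_lipschitz_vec)
  fix k
  show "compactly_lipschitz_on (- diagonals) (\<lambda>x. uncontrolled_field x $ k)"
  proof (cases k)
    case None
    then show ?thesis using F_last_lip by (simp add: uncontrolled_field_def)
  next
    case (Some i)
    have "1-lipschitz_on UNIV (\<lambda>y :: (real ^ 'd) ^ 'n. y $ i)"
      by (rule lipschitz_onI)
         (auto simp: dist_norm Finite_Cartesian_Product.norm_nth_le simp flip: vector_minus_component)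
    from compactly_lipschitz_compose[OF lipschitz_imp_compactly_lipschitz[OF this] driven_velocity_compactly_lipschitz]
    show ?thesis using Some by (simp add: uncontrolled_field_def)
  qed
qed

lemma uncontrolled_field_continuous: "continuous_on (- diagonals) uncontrolled_field"
  unfolding uncontrolled_field_def by (intro continuous_intros driven_velocity_continuous F_cont)

lemma bounded_linear_init_part: "bounded_linear (init_part :: (real ^ 'd) ^ 'n option \<Rightarrow> _)"
  by (rule bounded_linear_intro[where K = 1]) (auto simp: vec_eq_iff norm_init_part_le)

lemma bounded_linear_append_last_0:
  "bounded_linear (append_last 0 :: real ^ 'd \<Rightarrow> (real ^ 'd) ^ 'n option)"
proof (rule bounded_linear_intro[where K = 1])
  show "append_last 0 (x + y) = append_last 0 x + (append_last 0 y :: (real ^ 'd) ^ 'n option)" for x y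
    by (rule append_last_eqI) (auto simp: vec_eq_iff)
  show "append_last 0 (r *\<^sub>R x) = r *\<^sub>R (append_last 0 x :: (real ^ 'd) ^ 'n option)" for r x
    by (rule append_last_eqI) (auto simp: vec_eq_iff)
  show "norm (append_last 0 x :: (real ^ 'd) ^ 'n option) \<le> norm x * 1" for x
    using norm_append_last_le[of 0 x] by simp
qed

text \<open>
  The defect \<open>h\<close> of \<open>X\<close> in the integrated equation is carried by the controlled particle alone. It
  is approximated uniformly by the primitive of a test function \<open>\<zeta>\<close>. By Gronwall's inequality the
  solution with control \<open>\<zeta>\<close> then stays in a compact tube around \<open>X\<close> that avoids collisions,
  provided that the approximation is good enough for the Lipschitz constant of the field on that
  tube. The estimate is made for the truncated equation, so that no exit time has to be
  discussed.
\<close>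
lemma smooth_control_near:
  assumes T: "T > 0" and X: "driven 0 T X" and e: "e > 0"
  obtains \<zeta> x where "\<zeta> \<in> Cc_infinity 0 T" "x 0 = X 0"
    "\<And>t. t \<in> {0..T} \<Longrightarrow> x t \<notin> diagonals" "\<And>t. t \<in> {0..T} \<Longrightarrow> norm (x t - X t) \<le> e"
    "\<And>t. t \<in> {0..T} \<Longrightarrow> (x has_vector_derivative uncontrolled_field (x t) + append_last 0 (\<zeta> t)) (at t within {0..T})"
proof -
  define C where "C = X ` {0..T}"
  have Xc: "continuous_on {0..T} X" by (rule drivenD(1)[OF X])
  have C: "compact C" "C \<noteq> {}" "C \<subseteq> - diagonals"
    using T drivenD(2)[OF X] Xc by (auto simp: C_def intro: compact_continuous_image)
  obtain r0 where r0: "r0 > 0" "{x. infdist x C \<le> r0} \<subseteq> - diagonals"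
    using compact_in_open_separated[OF C(2,1) _ C(3)] closed_diagonals by (metis open_Compl)
  define S where "S = {x. infdist x C \<le> r0}"
  have S: "compact S" "S \<subseteq> - diagonals"
    using compact_infdist_le[OF C(2,1) r0(1)] r0(2) by (auto simp: S_def)
  define r where "r = min e r0"
  have r: "r > 0" "r \<le> e" "r \<le> r0" using e r0 by (auto simp: r_def)
  have inS: "x \<in> S" if "t \<in> {0..T}" "x \<in> cball (X t) r" for t x
  proof -
    have "infdist x C \<le> dist x (X t)" by (rule infdist_le) (use that in \<open>auto simp: C_def\<close>)
    then show ?thesis using that r by (simp add: S_def dist_commute)
  qed
  obtain L where L: "L > 0" "L-lipschitz_on S uncontrolled_field"
    using compactly_lipschitz_onD[OF uncontrolled_field_compactly_lipschitz S] .
  have uncontrolled_field_cont: "continuous_on {0..T} (\<lambda>s. uncontrolled_field (y s))"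
    if "continuous_on {0..T} y" "\<And>t. t \<in> {0..T} \<Longrightarrow> y t \<in> S" for y
    by (rule continuous_on_compose2[OF uncontrolled_field_continuous that(1)]) (use that(2) S(2) in blast)
  have XS: "X t \<in> S" if "t \<in> {0..T}" for t using inS[OF that] r by simp
  note fX = uncontrolled_field_cont[OF Xc XS]
  define h where "h t = X t - X 0 - integral {0..t} (\<lambda>s. uncontrolled_field (X s))" for t
  have h_cont: "continuous_on {0..T} h"
    unfolding h_def by (intro continuous_intros Xc indefinite_integral_continuous_1 integrable_continuous_real fX)
  have h0: "h 0 = 0" by (simp add: h_def)
  have h_init: "h t = append_last 0 (h t $ None)" if t: "t \<in> {0..T}" for t
  proof -
    have "(\<lambda>s. uncontrolled_field (X s)) integrable_on {0..t}"
      by (intro integrable_continuous_real continuous_on_subset[OF fX]) (use t in auto)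
    from integral_linear[OF this bounded_linear_init_part]
    have "init_part (integral {0..t} (\<lambda>s. uncontrolled_field (X s))) = integral {0..t} (\<lambda>s. driven_velocity (X s))"
      by (simp add: o_def uncontrolled_field_def)
    then have "init_part (h t) = 0"
      using drivenD(3)[OF X t] unfolding h_def by (simp flip: init_part_diff)
    then show ?thesis using append_last_eqI by metis
  qed
  define \<delta> where "\<delta> = r / (2 * exp (2 * L * T))"
  have \<delta>: "\<delta> > 0" using r by (simp add: \<delta>_def)
  obtain \<zeta> where \<zeta>: "\<zeta> \<in> Cc_infinity 0 T" "continuous_on UNIV \<zeta>"
    "\<And>t. t \<in> {0..T} \<Longrightarrow> norm (integral {0..t} \<zeta> - (h t $ None - h 0 $ None)) \<le> \<delta>"
    by (rule approximate_by_integral_of_test_function[OF T _ \<delta>, of "\<lambda>t. h t $ None"])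
       (auto intro!: continuous_intros h_cont)
  have \<zeta>_int: "\<zeta> integrable_on {a..b}" for a b
    by (intro integrable_continuous_real continuous_on_subset[OF \<zeta>(2)]) auto
  define k :: "real \<Rightarrow> (real ^ 'd) ^ 'n option"
    where "k t = append_last 0 (integral {0..t} \<zeta>)" for t
  have k_cont: "continuous_on {0..T} k"
    unfolding k_def by (intro continuous_intros indefinite_integral_continuous_1 \<zeta>_int)
  have kh: "norm (k t - h t) \<le> \<delta>" if t: "t \<in> {0..T}" for t
  proof -
    have "k t - h t = append_last 0 (integral {0..t} \<zeta> - (h t $ None - h 0 $ None))"
      by (subst h_init[OF t]) (simp add: k_def append_last_diff h0)
    also have "norm \<dots> \<le> norm (integral {0..t} \<zeta> - (h t $ None - h 0 $ None))"
      using norm_append_last_le[of 0 "integral {0..t} \<zeta> - (h t $ None - h 0 $ None)"] by simp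
    finally show ?thesis using \<zeta>(3)[OF t] by linarith
  qed
  have cont: "continuous_on {(t, x). t \<in> {0..T} \<and> x \<in> cball (X t) r} (\<lambda>(t, x). uncontrolled_field x)"
    unfolding split_beta
    by (rule continuous_on_compose2[OF uncontrolled_field_continuous]) (use inS S in \<open>auto intro!: continuous_intros\<close>)
  have lip: "norm (uncontrolled_field x - uncontrolled_field y) \<le> L * norm (x - y)" if "x \<in> S" "y \<in> S" for x y
    using lipschitz_onD[OF L(2) that] by (simp add: dist_norm)
  obtain x q where x: "continuous_on {0..T} x" "continuous_on {0..T} q"
    "continuous_on {0..T} (\<lambda>s. uncontrolled_field (q s))"
    "\<And>t. t \<in> {0..T} \<Longrightarrow> x t = X 0 + k t + integral {0..t} (\<lambda>s. uncontrolled_field (q s))"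
    "\<And>t. q t \<in> cball (X t) r" "\<And>t. x t \<in> cball (X t) r \<Longrightarrow> q t = x t"
    "\<And>t. norm (q t - X t) \<le> norm (x t - X t)"
  proof (rule picard_in_tube[where H = "\<lambda>_. uncontrolled_field" and c = X and g = "\<lambda>t. X 0 + k t"
        and a = 0 and b = T and L = L and r = r, OF _ L(1) _ cont])
    show "norm (uncontrolled_field x - uncontrolled_field y) \<le> L * norm (x - y)"
      if "t \<in> {0..T}" "x \<in> cball (X t) r" "y \<in> cball (X t) r" for t x y
      using that inS by (intro lip) blast+
  qed (use T r Xc in \<open>auto intro!: continuous_intros k_cont\<close>)
  have close: "norm (x t - X t) \<le> r" if t: "t \<in> {0..T}" for t
  proof -
    have "norm (x t - X t) \<le> 2 * \<delta> * exp (2 * L * (t - 0))"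
    proof (rule gronwall[where b = T, OF _ L(1)])
      show "continuous_on {0..T} (\<lambda>t. norm (x t - X t))" by (intro continuous_intros x Xc)
      fix s assume s: "s \<in> {0..T}"
      have sub: "{0..s} \<subseteq> {0..T}" using s by auto
      have "x s - X s = (k s - h s) + (integral {0..s} (\<lambda>s. uncontrolled_field (q s)) - integral {0..s} (\<lambda>s. uncontrolled_field (X s)))"
        using x(4)[OF s] by (simp add: h_def)
      also have "integral {0..s} (\<lambda>s. uncontrolled_field (q s)) - integral {0..s} (\<lambda>s. uncontrolled_field (X s))
          = integral {0..s} (\<lambda>s. uncontrolled_field (q s) - uncontrolled_field (X s))"
        by (subst integral_diff)
           (auto intro!: integrable_continuous_real continuous_on_subset[OF x(3) sub] continuous_on_subset[OF fX sub])
      also have "norm (k s - h s + integral {0..s} (\<lambda>s. uncontrolled_field (q s) - uncontrolled_field (X s)))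
          \<le> \<delta> + integral {0..s} (\<lambda>s. L * norm (x s - X s))"
      proof (rule norm_triangle_mono[OF kh[OF s]], rule integral_norm_bound_integral)
        show "norm (uncontrolled_field (q u) - uncontrolled_field (X u)) \<le> L * norm (x u - X u)" if "u \<in> {0..s}" for u
        proof -
          have u: "u \<in> {0..T}" using that s by auto
          have "norm (uncontrolled_field (q u) - uncontrolled_field (X u)) \<le> L * norm (q u - X u)"
            by (rule lip[OF inS[OF u x(5)] XS[OF u]])
          also have "\<dots> \<le> L * norm (x u - X u)" using L x(7) by (intro mult_left_mono) auto
          finally show ?thesis .
        qed
      qed (auto intro!: integrable_continuous_real continuous_intros continuous_on_subset[OF x(3) sub]
             continuous_on_subset[OF fX sub] continuous_on_subset[OF x(1) sub] continuous_on_subset[OF Xc sub])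
      finally show "norm (x s - X s) \<le> \<delta> + L * integral {0..s} (\<lambda>s. norm (x s - X s))"
        by simp
    qed (use t \<delta> in auto)
    also have "\<dots> \<le> 2 * \<delta> * exp (2 * L * T)" using t \<delta> L by simp
    also have "\<dots> = r" by (simp add: \<delta>_def)
    finally show ?thesis .
  qed
  have tube: "x t \<in> cball (X t) r" if "t \<in> {0..T}" for t
    using close[OF that] by (simp add: dist_norm norm_minus_commute)
  show ?thesis
  proof (rule that[OF \<zeta>(1)])
    show "x 0 = X 0"
      using x(4)[of 0] T bounded_linear.linear[OF bounded_linear_append_last_0]
      by (simp add: k_def linear_0)
    show "x t \<notin> diagonals" "norm (x t - X t) \<le> e" if "t \<in> {0..T}" for t
      using inS[OF that tube[OF that]] S close[OF that] r by auto
    fix t assume t: "t \<in> {0..T}"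
    have "((\<lambda>t. X 0 + k t + integral {0..t} (\<lambda>s. uncontrolled_field (q s))) has_vector_derivative
        0 + append_last 0 (\<zeta> t) + uncontrolled_field (q t)) (at t within {0..T})"
      unfolding k_def
      by (intro has_vector_derivative_add has_vector_derivative_const
          bounded_linear.has_vector_derivative[OF bounded_linear_append_last_0]
          integral_has_vector_derivative t x(3) continuous_on_subset[OF \<zeta>(2)]) simp
    then have "(x has_vector_derivative 0 + append_last 0 (\<zeta> t) + uncontrolled_field (q t)) (at t within {0..T})"
      by (rule has_vector_derivative_transform[OF t, rotated]) (use x(4) in auto)
    then show "(x has_vector_derivative uncontrolled_field (x t) + append_last 0 (\<zeta> t)) (at t within {0..T})"
      using x(6)[OF tube[OF t]] by (simp add: add.commute)
  qed
qed

lemma solves_system_iff: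
  "solves_system K F \<zeta> T x_in x \<longleftrightarrow> x 0 = x_in \<and> (\<forall>t\<in>{0..T}. x t \<notin> diagonals \<and>
     (x has_vector_derivative uncontrolled_field (x t) + append_last 0 (\<zeta> t)) (at t within {0..T}))"
proof -
  have "(x has_vector_derivative v) (at t within S) \<longleftrightarrow>
      (\<forall>k. ((\<lambda>s. x s $ k) has_vector_derivative v $ k) (at t within S))"
    for x :: "real \<Rightarrow> (real ^ 'd) ^ 'n option" and v t S
  proof
    assume "(x has_vector_derivative v) (at t within S)"
    then show "\<forall>k. ((\<lambda>s. x s $ k) has_vector_derivative v $ k) (at t within S)"
      by (auto intro: bounded_linear.has_vector_derivative[OF bounded_linear_vec_nth])
  next
    assume *: "\<forall>k. ((\<lambda>s. x s $ k) has_vector_derivative v $ k) (at t within S)"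
    show "(x has_vector_derivative v) (at t within S)"
      unfolding has_vector_derivative_def
    proof (subst has_derivative_componentwise_within, safe)
      fix e :: "(real ^ 'd) ^ 'n option" assume "e \<in> Basis"
      then obtain k u where e: "e = axis k u" by (auto simp: Basis_vec_def)
      show "((\<lambda>s. x s \<bullet> e) has_derivative (\<lambda>s. (s *\<^sub>R v) \<bullet> e)) (at t within S)"
        using bounded_linear.has_derivative[OF bounded_linear_inner_left *[rule_format, of k, unfolded has_vector_derivative_def], of u]
        by (simp add: e inner_axis)
    qed
  qed
  then show ?thesis
    unfolding solves_system_def by (auto simp: uncontrolled_field_def driven_velocity_def split_option_all)
qed

text \<open>
  The control cancels in the difference of two solutions, and the field is Lipschitz on the union of
  their compact ranges.
\<close>
lemma solution_unique:
  assumes x: "solves_system K F \<zeta> T x_in x" and y: "solves_system K F \<zeta> T x_in y" and t: "t \<in> {0..T}"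
  shows "y t = x t"
proof -
  have dx: "(x has_vector_derivative uncontrolled_field (x s) + append_last 0 (\<zeta> s)) (at s within {0..T})"
    and dy: "(y has_vector_derivative uncontrolled_field (y s) + append_last 0 (\<zeta> s)) (at s within {0..T})"
    if "s \<in> {0..T}" for s
    using x y that by (auto simp: solves_system_iff)
  have xc: "continuous_on {0..T} x" and yc: "continuous_on {0..T} y"
    unfolding continuous_on_eq_continuous_within
    using has_vector_derivative_continuous[OF dx] has_vector_derivative_continuous[OF dy] by blast+
  define S where "S = x ` {0..T} \<union> y ` {0..T}"
  have S: "compact S" "S \<subseteq> - diagonals"
    using x y by (auto simp: S_def solves_system_iff intro!: compact_Un compact_continuous_image xc yc)
  obtain L where L: "L > 0" "L-lipschitz_on S uncontrolled_field"
    using compactly_lipschitz_onD[OF uncontrolled_field_compactly_lipschitz S] .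
  have "norm (y t - x t) \<le> 2 * 0 * exp (2 * L * (t - 0))"
  proof (rule gronwall[where b = T, OF _ L(1)])
    show "continuous_on {0..T} (\<lambda>t. norm (y t - x t))" by (intro continuous_intros xc yc)
    fix s assume s: "s \<in> {0..T}"
    have "((\<lambda>u. uncontrolled_field (y u) - uncontrolled_field (x u)) has_integral (y s - x s) - (y 0 - x 0)) {0..s}"
    proof (rule fundamental_theorem_of_calculus)
      fix u assume u: "u \<in> {0..s}"
      have "((\<lambda>u. y u - x u) has_vector_derivative
          (uncontrolled_field (y u) + append_last 0 (\<zeta> u)) - (uncontrolled_field (x u) + append_last 0 (\<zeta> u))) (at u within {0..T})"
        by (intro has_vector_derivative_diff dx dy) (use u s in auto)
      then show "((\<lambda>u. y u - x u) has_vector_derivative uncontrolled_field (y u) - uncontrolled_field (x u)) (at u within {0..s})"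
        by (rule has_vector_derivative_within_subset[THEN has_vector_derivative_eq_rhs]) (use s in auto)
    qed (use s in auto)
    then have int: "((\<lambda>u. uncontrolled_field (y u) - uncontrolled_field (x u)) has_integral y s - x s) {0..s}"
      using x y by (simp add: solves_system_iff)
    have "norm (integral {0..s} (\<lambda>u. uncontrolled_field (y u) - uncontrolled_field (x u))) \<le> integral {0..s} (\<lambda>u. L * norm (y u - x u))"
    proof (rule integral_norm_bound_integral)
      show "norm (uncontrolled_field (y u) - uncontrolled_field (x u)) \<le> L * norm (y u - x u)" if "u \<in> {0..s}" for u
        using lipschitz_onD[OF L(2), of "y u" "x u"] that s by (simp add: S_def dist_norm)
      show "(\<lambda>u. L * norm (y u - x u)) integrable_on {0..s}"
        by (intro integrable_continuous_real continuous_intros continuous_on_subset[OF xc] continuous_on_subset[OF yc])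
           (use s in auto)
    qed (use int in blast)
    then show "norm (y s - x s) \<le> 0 + L * integral {0..s} (\<lambda>s. norm (y s - x s))"
      using int by (simp add: integral_unique)
  qed (use t in auto)
  then show ?thesis by simp
qed

end

section \<open>Approximate controllability\<close>

theorem theorem1p6:
  fixes K :: "'n::finite \<Rightarrow> real ^ 'd \<Rightarrow> real ^ 'd"
    and F :: "'n option \<Rightarrow> (real ^ 'd) ^ ('n option) \<Rightarrow> real ^ 'd"
    and F_tilde :: "'n \<Rightarrow> (real ^ 'd) ^ 'n \<Rightarrow> real ^ 'd"
    and F_hat :: "'n \<Rightarrow> (real ^ 'd) ^ ('n option) \<Rightarrow> real ^ 'd"
    and f :: "'n \<Rightarrow> real \<Rightarrow> real"
    and A :: "'n \<Rightarrow> real ^ 'd ^ 'd"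
    and p :: "'n \<Rightarrow> real"
    and T \<epsilon> :: real
    and x_in x_fin :: "(real ^ 'd) ^ ('n option)"
    and c :: "real \<Rightarrow> (real ^ 'd) ^ 'n"
  assumes dim: "CARD('d) \<ge> 2"
    and F_cont: "\<And>k. continuous_on (- diagonals) (F k)"
    and K_cont: "\<And>i. continuous_on (- {0}) (K i)"
    and F_split: "\<And>i x. x \<notin> diagonals \<Longrightarrow> F (Some i) x = F_tilde i (init_part x) + F_hat i x"
    and F_tilde_lip: "\<And>i. locally_lipschitz_on (- diagonals) (F_tilde i)"
    and F_hat_lip: "\<And>i. locally_lipschitz_on UNIV (F_hat i)"
    and F_last_lip: "locally_lipschitz_on (- diagonals) (F None)"
    and K_eq: "\<And>i z. z \<noteq> 0 \<Longrightarrow> K i z = f i (norm z) *\<^sub>R ((A i *v z) /\<^sub>R (norm z powr p i))"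
    and A_inv: "\<And>i. invertible (A i)"
    and f_bounded: "\<And>i. bounded (f i ` {0..})"
    and f_lip: "\<And>i. \<exists>L. L-lipschitz_on {0..} (f i)"
    and f_0: "\<And>i. f i 0 \<noteq> 0"
    and p_gt_1: "\<And>i. p i > 1"
    and T_pos: "T > 0"
    and x_in: "x_in \<notin> diagonals"
    and x_fin: "x_fin \<notin> diagonals"
    and \<epsilon>_pos: "\<epsilon> > 0"
    and c_cont: "continuous_on {0..T} c"
    and c_off_diag: "\<And>t. t \<in> {0..T} \<Longrightarrow> c t \<notin> diagonals"
    and c_start: "append_last (c 0) (x_in $ None) = x_in"
    and c_end: "append_last (c T) (x_fin $ None) = x_fin"
  shows "\<exists>\<zeta> \<in> Cc_infinity 0 T. \<exists>x.
           solves_system K F \<zeta> T x_in x \<and>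
           (\<forall>y. solves_system K F \<zeta> T x_in y \<longrightarrow> (\<forall>t\<in>{0..T}. y t = x t)) \<and>
           (SUP t\<in>{0..T}. \<Sum>i\<in>UNIV. norm (c t $ i - x t $ Some i))
             + norm (x T $ None - x_fin $ None) < \<epsilon>"
proof -
  interpret driven_particles K F F_tilde F_hat f A p
    by unfold_locales (fact assms locally_lipschitz_on_imp_compactly[OF F_tilde_lip]
      locally_lipschitz_on_imp_compactly[OF F_hat_lip] locally_lipschitz_on_imp_compactly[OF F_last_lip])+
  define N where "N = real CARD('n)"
  define e where "e = \<epsilon> / (4 * (N + 1))"
  have N: "N + 1 > 0" by (simp add: N_def add_nonneg_pos)
  have e: "e > 0" using \<epsilon>_pos N by (simp add: e_def)
  have init: "init_part x_in = c 0" "init_part x_fin = c T"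
    by (metis c_start init_part_append_last) (metis c_end init_part_append_last)
  obtain X where X: "driven 0 T X" "X 0 = x_in"
    "\<And>t j. t \<in> {0..T} \<Longrightarrow> norm (X t $ Some j - c t $ j) \<le> e"
    "norm (X T $ None - x_fin $ None) \<le> e"
    using shadow_curve[OF T_pos c_cont c_off_diag x_in init(1) x_fin init(2) e] by blast
  obtain \<zeta> x where \<zeta>: "\<zeta> \<in> Cc_infinity 0 T" and x: "x 0 = X 0"
    "\<And>t. t \<in> {0..T} \<Longrightarrow> x t \<notin> diagonals" "\<And>t. t \<in> {0..T} \<Longrightarrow> norm (x t - X t) \<le> e"
    "\<And>t. t \<in> {0..T} \<Longrightarrow> (x has_vector_derivative uncontrolled_field (x t) + append_last 0 (\<zeta> t)) (at t within {0..T})"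
    using smooth_control_near[OF T_pos X(1) e, of thesis] by blast
  have sol: "solves_system K F \<zeta> T x_in x"
    using x X(2) by (simp add: solves_system_iff)
  have xk: "norm (x t $ k - X t $ k) \<le> e" if "t \<in> {0..T}" for t k
    using x(3)[OF that] Finite_Cartesian_Product.norm_nth_le[of "x t - X t" k] by simp
  have close: "norm (c t $ i - x t $ Some i) \<le> 2 * e" if "t \<in> {0..T}" for t i
    using norm_triangle_mono[OF xk[OF that, of "Some i"] X(3)[OF that, of i]]
    by (simp add: norm_minus_commute)
  have "(SUP t\<in>{0..T}. \<Sum>i\<in>UNIV. norm (c t $ i - x t $ Some i)) \<le> N * (2 * e)"
  proof (rule cSUP_least)
    fix t assume "t \<in> {0..T}"
    then have "(\<Sum>i\<in>UNIV. norm (c t $ i - x t $ Some i)) \<le> (\<Sum>i\<in>(UNIV :: 'n set). 2 * e)"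
      by (intro sum_mono close)
    then show "(\<Sum>i\<in>UNIV. norm (c t $ i - x t $ Some i)) \<le> N * (2 * e)" by (simp add: N_def)
  qed (use T_pos in auto)
  moreover have "norm (x T $ None - x_fin $ None) \<le> 2 * e"
    using norm_triangle_mono[OF xk[of T None] X(4)] T_pos by simp
  moreover have "N * (2 * e) + 2 * e < \<epsilon>"
  proof -
    have "\<epsilon> = 4 * (N + 1) * e" using N by (simp add: e_def)
    then have "N * (2 * e) + 2 * e = \<epsilon> / 2" by (simp add: algebra_simps)
    then show ?thesis using \<epsilon>_pos by simp
  qed
  ultimately have "(SUP t\<in>{0..T}. \<Sum>i\<in>UNIV. norm (c t $ i - x t $ Some i))
      + norm (x T $ None - x_fin $ None) < \<epsilon>" by linarith
  moreover have "\<forall>y. solves_system K F \<zeta> T x_in y \<longrightarrow> (\<forall>t\<in>{0..T}. y t = x t)"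
    using solution_unique[OF sol] by blast
  ultimately show ?thesis using \<zeta> sol by blast
qed

end
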